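(* Let $\varepsilon>0$, let $m>1$ be the number of colors, and assume $\varepsilon\le p_i\le1-\varepsilon$ for $i=1,\dots,N$. (i) (Case $\gamma=1$.) There exists $c_\varepsilon>0$, depending only on $\varepsilon$, such that for any $N\ge2$ and any $\omega$ such that $0<\rho<1$, $$\lambda_1(N,\omega)\ge c_\varepsilon .$$ (ii) (Case $\gamma=0$.) There exists $c_\varepsilon>0$, depending only on $\varepsilon$, such that for any $N\ge2$ and any $\omega$ with $0<\rho<1$, $$\lambda_0(N,\omega)\ge c_\varepsilon\,(1-\rho).$$
   Context: Colored exclusion process with site disorder. Let $m\geq 1$ be the number of colors and $p_1,\dots,p_N\in(0,1)$. Configurations are $\eta\in\{0,1,\dots,m\}^N$; $\eta_i=0$ means site $i$ is empty, $\eta_i=k\ge1$ means $i$ is occupied by a particle of color $k$. Let $\psi_i=1_{\{\eta_i\ge1\}}$ and $\psi=(\psi_1,\dots,\psi_N)$. Let $\mu_i$ be the probability on $\{0,\dots,m\}$ with $$\mu_i(\eta_i=k)=\frac1{Z_i}\bigl(p_i1_{\{k\ge1\}}+(1-p_i)1_{\{k=0\}}\bigr),\qquad Z_i=(m-1)p_i+1 .$$ For $\omega=(\omega_1,\dots,\omega_m)$ with non-negative integers $\omega_k$ satisfying $\sum_{k=1}^m\omega_k\le N$, let $\Omega_{N,\omega}$ be the set of $\eta\in\{0,\dots,m\}^N$ with $\sum_{i=1}^N1_{\{\eta_i=k\}}=\omega_k$ for every $k=1,\dots,m$, and let $\nu$ be $\mu_1\times\cdots\times\mu_N$ conditioned on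 $\Omega_{N,\omega}$. The global density is $\rho=\frac1N\sum_{k=1}^m\omega_k$. For $\gamma\ge0$ the generator, self-adjoint in $L^2(\nu)$, is $$\mathcal{L}_\gamma f(\eta)=\frac1N\sum_b c_b^\gamma(\eta)\bigl(f(\eta^b)-f(\eta)\bigr),$$ where the sum is over unordered pairs $b=\{i,j\}$ of distinct indices in $\{1,\dots,N\}$, $\eta^b$ is $\eta$ with $\eta_i$ and $\eta_j$ exchanged, and $$c_b^\gamma(\eta)=c_b(\psi)+\frac\gamma2\,1_{\{\psi_i=\psi_j\}},\qquad c_b(\psi)=\frac{p_i(1-p_j)\,\psi_j(1-\psi_i)+p_j(1-p_i)\,\psi_i(1-\psi_j)}{p_i(1-p_j)+p_j(1-p_i)} .$$ The spectral gap of $\mathcal{L}_\gamma$ is $$\lambda_\gamma(N,\omega)=\inf\left\{\frac{\nu(f(-\mathcal{L}_\gamma)f)}{\nu(f^2)}:\ f:\Omega_{N,\omega}\to\mathbb{R},\ f\ne0,\ \nu(f)=0\right\}.$$ *)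

theory Defs
  imports
    "HOL-Probability.Probability"
    "HOL-Probability.Product_PMF"
    "HOL-Combinatorics.Transposition"
begin

text \<open>
  A configuration is a function \<^term>\<open>\<eta> :: nat \<Rightarrow> nat\<close> with values in \<open>{0..m}\<close> on the sites
  \<open>{1..N}\<close> and with the default value \<open>0\<close> elsewhere (the convention of \<^const>\<open>Pi_pmf\<close> and
  \<^const>\<open>PiE_dflt\<close>). Only the values \<open>p 1, \<dots>, p N\<close> and \<open>\<omega> 1, \<dots>, \<omega> m\<close> of the functions
  \<open>p\<close> and \<open>\<omega>\<close> are used.
\<close>

definition occ :: "(nat \<Rightarrow> nat) \<Rightarrow> nat \<Rightarrow> real" where
  "occ \<eta> i = of_bool (\<eta> i \<ge> 1)"

text \<open>The single-site law; \<open>q\<close> stands for \<open>p\<^sub>i\<close>. It is a genuine mass function for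
  \<open>0 \<le> q \<le> 1\<close> and \<open>m \<ge> 1\<close>, see \<open>pmf_site_law\<close> below.\<close>

definition site_law :: "nat \<Rightarrow> real \<Rightarrow> nat pmf" where
  "site_law m q = embed_pmf (\<lambda>k. if k \<le> m
     then (q * of_bool (k \<ge> 1) + (1 - q) * of_bool (k = 0)) / ((real m - 1) * q + 1) else 0)"

definition configs :: "nat \<Rightarrow> nat \<Rightarrow> (nat \<Rightarrow> nat) \<Rightarrow> (nat \<Rightarrow> nat) set" where
  "configs m N \<omega> = {\<eta> \<in> PiE_dflt {1..N} 0 (\<lambda>_. {0..m}).
     \<forall>k\<in>{1..m}. (\<Sum>i = 1..N. of_bool (\<eta> i = k)) = \<omega> k}"

definition nu :: "nat \<Rightarrow> nat \<Rightarrow> (nat \<Rightarrow> real) \<Rightarrow> (nat \<Rightarrow> nat) \<Rightarrow> (nat \<Rightarrow> nat) pmf" where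
  "nu m N p \<omega> = cond_pmf (Pi_pmf {1..N} 0 (\<lambda>i. site_law m (p i))) (configs m N \<omega>)"

definition global_density :: "nat \<Rightarrow> nat \<Rightarrow> (nat \<Rightarrow> nat) \<Rightarrow> real" where
  "global_density m N \<omega> = (\<Sum>k = 1..m. real (\<omega> k)) / real N"

definition base_rate :: "(nat \<Rightarrow> real) \<Rightarrow> nat \<Rightarrow> nat \<Rightarrow> (nat \<Rightarrow> real) \<Rightarrow> real" where
  "base_rate p i j \<psi> =
     (p i * (1 - p j) * \<psi> j * (1 - \<psi> i) + p j * (1 - p i) * \<psi> i * (1 - \<psi> j))
       / (p i * (1 - p j) + p j * (1 - p i))"

definition rate :: "real \<Rightarrow> (nat \<Rightarrow> real) \<Rightarrow> nat \<Rightarrow> nat \<Rightarrow> (nat \<Rightarrow> nat) \<Rightarrow> real" where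
  "rate \<gamma> p i j \<eta> = base_rate p i j (occ \<eta>) + \<gamma> / 2 * of_bool (occ \<eta> i = occ \<eta> j)"

text \<open>The unordered pair \<open>{i, j}\<close> is represented by \<open>(i, j)\<close> with \<open>i < j\<close>; the summand does
  not depend on the order of \<open>i\<close> and \<open>j\<close>, see \<open>rate_commute\<close> below.\<close>

definition generator ::
  "real \<Rightarrow> nat \<Rightarrow> (nat \<Rightarrow> real) \<Rightarrow> ((nat \<Rightarrow> nat) \<Rightarrow> real) \<Rightarrow> (nat \<Rightarrow> nat) \<Rightarrow> real" where
  "generator \<gamma> N p f \<eta> =
     1 / real N * (\<Sum>(i, j) \<in> {(i, j). 1 \<le> i \<and> i < j \<and> j \<le> N}.
       rate \<gamma> p i j \<eta> * (f (\<eta> \<circ> Transposition.transpose i j) - f \<eta>))"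

text \<open>A function on \<^term>\<open>configs m N \<omega>\<close> is given by a total function, of which only the values
  on \<^term>\<open>configs m N \<omega>\<close> matter: this set is the support of \<^const>\<open>nu\<close> and is invariant under
  exchanging two sites. The infimum is over a nonempty set bounded below as soon as
  \<^term>\<open>configs m N \<omega>\<close> has two elements, in particular for \<open>0 < \<rho> < 1\<close>.\<close>

definition spectral_gap ::
  "real \<Rightarrow> nat \<Rightarrow> nat \<Rightarrow> (nat \<Rightarrow> real) \<Rightarrow> (nat \<Rightarrow> nat) \<Rightarrow> real" where
  "spectral_gap \<gamma> m N p \<omega> = Inf
     {measure_pmf.expectation (nu m N p \<omega>) (\<lambda>\<eta>. f \<eta> * (- generator \<gamma> N p f \<eta>)) /
      measure_pmf.expectation (nu m N p \<omega>) (\<lambda>\<eta>. (f \<eta>)\<^sup>2) | f.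
      (\<exists>\<eta>\<in>configs m N \<omega>. f \<eta> \<noteq> 0) \<and> measure_pmf.expectation (nu m N p \<omega>) f = 0}"

lemma rate_commute: "rate \<gamma> p i j \<eta> = rate \<gamma> p j i \<eta>"
  by (simp add: rate_def base_rate_def add.commute eq_commute)

lemma pmf_site_law:
  assumes "m \<ge> 1" and q: "0 \<le> q" "q \<le> 1"
  shows "pmf (site_law m q) k = (if k \<le> m
     then (q * of_bool (k \<ge> 1) + (1 - q) * of_bool (k = 0)) / ((real m - 1) * q + 1) else 0)"
proof -
  define Z where "Z = (real m - 1) * q + 1"
  define g where "g k = (if k \<le> m
     then (q * of_bool (k \<ge> 1) + (1 - q) * of_bool (k = 0)) / Z else 0)" for k :: nat
  have "(real m - 1) * q \<ge> 0" using assms by simp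
  hence Z: "Z > 0" by (simp add: Z_def)
  have nn: "g k \<ge> 0" for k using Z q by (simp add: g_def)
  have "(\<Sum>k\<in>{0..m}. g k) = g 0 + (\<Sum>k\<in>{1..m}. g k)"
    by (simp add: sum.atLeast_Suc_atMost)
  also have "(\<Sum>k\<in>{1..m}. g k) = (\<Sum>k\<in>{1..m}. q / Z)"
    by (intro sum.cong) (auto simp: g_def)
  also have "g 0 + \<dots> = ((1 - q) + real m * q) / Z"
    by (simp add: g_def add_divide_distrib)
  also have "(1 - q) + real m * q = Z"
    by (simp add: Z_def algebra_simps)
  also have "Z / Z = 1" using Z by simp
  finally have sum1: "(\<Sum>k\<in>{0..m}. g k) = 1" .
  have "(\<integral>\<^sup>+k. ennreal (g k) \<partial>count_space UNIV) = (\<integral>\<^sup>+k. ennreal (g k) \<partial>count_space {0..m})"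
    by (intro nn_integral_count_space_eq) (auto simp: g_def)
  also have "\<dots> = (\<Sum>k\<in>{0..m}. ennreal (g k))"
    by (simp add: nn_integral_count_space_finite)
  also have "\<dots> = 1"
    using nn sum1 by (simp add: sum_ennreal)
  finally have "pmf (embed_pmf g) k = g k"
    using nn by (intro pmf_embed_pmf) auto
  moreover have "site_law m q = embed_pmf g"
    unfolding site_law_def g_def[abs_def] Z_def ..
  ultimately show ?thesis by (simp add: g_def Z_def)
qed

lemma pmf_nu:
  assumes "m \<ge> 1" and p: "\<And>i. i \<in> {1..N} \<Longrightarrow> 0 < p i \<and> p i < 1" and "configs m N \<omega> \<noteq> {}"
  defines "M \<equiv> Pi_pmf {1..N} 0 (\<lambda>i. site_law m (p i))"
  shows "set_pmf (nu m N p \<omega>) = configs m N \<omega>"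
    and "pmf (nu m N p \<omega>) \<eta> =
      (if \<eta> \<in> configs m N \<omega> then pmf M \<eta> / measure_pmf.prob M (configs m N \<omega>) else 0)"
proof -
  have set_site: "set_pmf (site_law m (p i)) = {0..m}" if "i \<in> {1..N}" for i
  proof -
    have pi: "0 < p i" "p i < 1" using p[OF that] by auto
    have "(real m - 1) * p i \<ge> 0" using pi assms(1) by simp
    hence Z: "(real m - 1) * p i + 1 > 0" by simp
    show ?thesis
      using pi Z assms(1) by (auto simp: set_pmf_eq pmf_site_law)
  qed
  have "set_pmf M = PiE_dflt {1..N} 0 (\<lambda>_. {0..m})"
    unfolding M_def by (subst set_Pi_pmf) (use set_site in \<open>auto simp: PiE_dflt_def\<close>)
  hence sub: "configs m N \<omega> \<subseteq> set_pmf M" by (auto simp: configs_def)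
  hence ne: "set_pmf M \<inter> configs m N \<omega> \<noteq> {}" using assms(3) by auto
  show "set_pmf (nu m N p \<omega>) = configs m N \<omega>"
    unfolding nu_def M_def[symmetric] using set_cond_pmf[OF ne] sub by auto
  show "pmf (nu m N p \<omega>) \<eta> =
      (if \<eta> \<in> configs m N \<omega> then pmf M \<eta> / measure_pmf.prob M (configs m N \<omega>) else 0)"
    unfolding nu_def M_def[symmetric] using pmf_cond[OF ne] by simp
qed

end

theory Submission
  imports Defs "HOL-Combinatorics.Permutations"
begin

text \<open>
  Write \<open>f = g + h\<close> with \<open>g = \<nu>(f | \<psi>)\<close>. Since the \<open>\<gamma> = 0\<close> dynamics preserves functions of \<open>\<psi>\<close>, its
  Dirichlet form splits along this decomposition. On functions of \<open>\<psi>\<close> the heat bath dynamics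
  contracts the Lipschitz constant with respect to single exchanges, by path coupling, and for a
  reversible dynamics this implies a spectral gap of order \<open>\<epsilon>\<^sup>2\<close>. Given \<open>\<psi>\<close>, the colors are uniformly
  distributed on the \<open>n = \<rho> N\<close> occupied sites, so the gap of random transpositions bounds
  \<open>n \<nu>(h\<^sup>2)\<close> by the energy of exchanges between particles. These exchanges have a positive rate for
  \<open>\<gamma> = 1\<close>, which is enough for \<open>\<rho> \<ge> 1/2\<close>. For \<open>\<gamma> = 0\<close> they are simulated by three jumps
  through a hole; averaging over the \<open>N - n\<close> holes costs a factor \<open>n / (N - n)\<close>, and the factor
  \<open>n\<close> cancels.
\<close>

text \<open>The rates \<open>c_b\<close> are normalized so that an update of a pair with exactly one
  particle resamples the position of that particle from its conditional law: the rates of the two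
  arrangements add up to 1. Hence updating the pair on which two occupations differ removes the
  difference exactly, although the varying \<open>p i\<close> leave no symmetry between the sites.
  The coupling alone yields decay in a supremum norm, with a prefactor that may depend on
  \<open>N\<close>; self-adjointness discards the prefactor and keeps only the rate
  \<open>\<epsilon>\<^sup>2 / (2 * N)\<close> per step. The splitting has no cross term because the
  \<gamma> = 0 generator maps g to a function of \<psi>, and h is orthogonal to all of these. No
  single estimate of h is uniform in the density: direct exchanges give a factor \<rho>, jumps
  through holes a factor 1 - \<rho>. For \<gamma> = 1 one of the two is always at least 1/2, since
  the Dirichlet form increases with \<gamma> and so inherits the bound through holes at low density.
  For \<gamma> = 0 only the second is available, whence the factor 1 - \<rho> in the result.\<close>

abbreviation swap :: "('a \<Rightarrow> 'b) \<Rightarrow> 'a \<Rightarrow> 'a \<Rightarrow> 'a \<Rightarrow> 'b" where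
  "swap \<eta> i j \<equiv> \<eta> \<circ> Transposition.transpose i j"

section \<open>Exchanges, sums over pairs, existence of colorings\<close>

lemma swap_empty_iff:
  fixes \<eta> :: "'a \<Rightarrow> nat"
  assumes "\<eta> x = 0 \<longleftrightarrow> \<eta> y = 0"
  shows "swap \<eta> x y k = 0 \<longleftrightarrow> \<eta> k = 0"
  using assms by (simp add: Transposition.transpose_def)

text \<open>Conjugating the transposition of i and j by that of x and y gives the transposition of
  the images. In the coupling this says that matched updates of two configurations differing by the
  exchange of x and y leave them differing by that same exchange.\<close>

lemma swap_conjugate: "swap (swap \<eta> x y) (Transposition.transpose x y i) (Transposition.transpose x y j) = swap (swap \<eta> i j) x y"
proof -
  have "Transposition.transpose x y \<circ> Transposition.transpose (Transposition.transpose x y i) (Transposition.transpose x y j)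
      = Transposition.transpose i j \<circ> Transposition.transpose x y"
    by (auto simp: fun_eq_iff Transposition.transpose_def)
  thus ?thesis by (simp only: o_assoc[symmetric])
qed

lemma sum_pairs_eq_sum_less:
  fixes F :: "nat \<Rightarrow> nat \<Rightarrow> real"
  assumes sym: "\<And>i j. F i j = F j i" and diag: "\<And>i. F i i = 0"
  shows "(\<Sum>i = 1..N. \<Sum>j = 1..N. F i j) = 2 * (\<Sum>(i, j) \<in> {(i, j). 1 \<le> i \<and> i < j \<and> j \<le> N}. F i j)"
proof -
  let ?P = "{(i, j). 1 \<le> i \<and> i < j \<and> j \<le> N}" and ?Q = "{(i, j). 1 \<le> j \<and> j < i \<and> i \<le> N}"
  let ?D = "{(i, j). i = j \<and> i \<in> {1..N}}"
  have fin: "finite ?P" "finite ?Q" "finite ?D"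
    by (rule finite_subset[of _ "{1..N} \<times> {1..N}"]; auto)+
  have "(\<Sum>i = 1..N. \<Sum>j = 1..N. F i j) = (\<Sum>(i, j) \<in> {1..N} \<times> {1..N}. F i j)"
    by (rule sum.cartesian_product)
  also have "{1..N} \<times> {1..N} = ?P \<union> ?Q \<union> ?D" by auto
  also have "(\<Sum>(i, j) \<in> ?P \<union> ?Q \<union> ?D. F i j) = (\<Sum>(i, j) \<in> ?P \<union> ?Q. F i j) + (\<Sum>(i, j) \<in> ?D. F i j)"
    by (rule sum.union_disjoint) (use fin in auto)
  also have "(\<Sum>(i, j) \<in> ?P \<union> ?Q. F i j) = (\<Sum>(i, j) \<in> ?P. F i j) + (\<Sum>(i, j) \<in> ?Q. F i j)"
    by (rule sum.union_disjoint) (use fin in auto)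
  also have "(\<Sum>(i, j) \<in> ?D. F i j) = 0"
    by (rule sum.neutral) (auto simp: diag)
  also have "(\<Sum>(i, j) \<in> ?Q. F i j) = (\<Sum>(i, j) \<in> ?P. F i j)"
    by (rule sum.reindex_bij_witness[where i = prod.swap and j = prod.swap]) (auto simp: sym)
  finally show ?thesis by simp
qed

lemma sum_triple_factor:
  fixes a :: "'a \<Rightarrow> real" and R :: "'a \<Rightarrow> 'a \<Rightarrow> real"
  shows "(\<Sum>k\<in>S. \<Sum>i\<in>S. \<Sum>j\<in>S. a k * R i j) = (\<Sum>k\<in>S. a k) * (\<Sum>i\<in>S. \<Sum>j\<in>S. R i j)"
  by (simp only: sum_distrib_left[symmetric] sum_distrib_right[symmetric])

lemma convex_combination_bound:
  fixes a b c u v K :: real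
  assumes "0 \<le> a" "0 \<le> b" "a + b \<le> c" "\<bar>u\<bar> \<le> K" "\<bar>v\<bar> \<le> K"
  shows "\<bar>a * u + b * v\<bar> \<le> c * K"
proof -
  have "\<bar>a * u + b * v\<bar> \<le> a * \<bar>u\<bar> + b * \<bar>v\<bar>"
    using abs_triangle_ineq[of "a * u" "b * v"] assms(1,2) by (simp add: abs_mult)
  also have "\<dots> \<le> a * K + b * K" using assms by (intro add_mono mult_left_mono) auto
  also have "\<dots> \<le> c * K" unfolding distrib_right[symmetric] using assms by (intro mult_right_mono) auto
  finally show ?thesis .
qed

text \<open>Colors are removed one at a time: the sites of the last color are chosen freely and the
  others are colored on what remains. This makes \<open>configs\<close> nonempty, without which
  conditioning on it would be meaningless.\<close>

lemma coloring_exists: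
  fixes \<omega> :: "nat \<Rightarrow> nat"
  assumes "finite I" "(\<Sum>k = 1..M. \<omega> k) \<le> card I"
  shows "\<exists>\<eta>. (\<forall>i. \<eta> i \<le> M) \<and> (\<forall>i. i \<notin> I \<longrightarrow> \<eta> i = 0) \<and> (\<forall>k\<in>{1..M}. card {i \<in> I. \<eta> i = k} = \<omega> k)"
  using assms
proof (induction M arbitrary: I)
  case 0
  show ?case by (rule exI[of _ "\<lambda>_. 0"]) simp
next
  case (Suc M)
  have "\<omega> (Suc M) \<le> card I" using Suc.prems(2) by simp
  then obtain S where S: "S \<subseteq> I" "card S = \<omega> (Suc M)" by (rule obtain_subset_with_card_n)
  have "card (I - S) = card I - \<omega> (Suc M)"
    using S Suc.prems(1) by (simp add: card_Diff_subset finite_subset)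
  hence "(\<Sum>k = 1..M. \<omega> k) \<le> card (I - S)" using Suc.prems(2) by simp
  from Suc.IH[OF finite_Diff[OF Suc.prems(1)] this] obtain \<eta> where \<eta>: "\<And>i. \<eta> i \<le> M"
    "\<And>i. i \<notin> I - S \<Longrightarrow> \<eta> i = 0" "\<And>k. k \<in> {1..M} \<Longrightarrow> card {i \<in> I - S. \<eta> i = k} = \<omega> k" by blast
  define \<zeta> where "\<zeta> i = (if i \<in> S then Suc M else \<eta> i)" for i
  have "card {i \<in> I. \<zeta> i = k} = \<omega> k" if "k \<in> {1..Suc M}" for k
  proof (cases "k = Suc M")
    case True
    have "\<eta> i \<noteq> Suc M" for i using \<eta>(1)[of i] by auto
    hence "{i \<in> I. \<zeta> i = k} = S" using S True by (auto simp: \<zeta>_def)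
    thus ?thesis using S True by simp
  next
    case False
    hence "{i \<in> I. \<zeta> i = k} = {i \<in> I - S. \<eta> i = k}" by (auto simp: \<zeta>_def)
    thus ?thesis using \<eta>(3)[of k] that False by simp
  qed
  moreover have "\<zeta> i \<le> Suc M" for i using \<eta>(1)[of i] by (simp add: \<zeta>_def le_SucI)
  moreover have "\<zeta> i = 0" if "i \<notin> I" for i using \<eta>(2)[of i] S that by (auto simp: \<zeta>_def)
  ultimately show ?case by blast
qed

section \<open>Contraction and spectral gap\<close>

text \<open>Log-convexity makes the ratios of successive terms nondecreasing. If the first ratio
  \<open>r\<close> exceeded \<open>q\<close>, then \<open>b k\<close> would be at least
  \<open>r ^ k * b 0\<close> and eventually overtake \<open>C * q ^ k\<close>, however large
  \<open>C\<close> is.\<close>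

lemma log_convex_decay:
  fixes b :: "nat \<Rightarrow> real"
  assumes nonneg: "\<And>k. 0 \<le> b k"
    and convex: "\<And>k. (b (Suc k))\<^sup>2 \<le> b k * b (Suc (Suc k))"
    and bound: "\<And>k. b k \<le> C * q ^ k" and "0 < q"
  shows "b 1 \<le> q * b 0"
proof (rule ccontr)
  assume "\<not> b 1 \<le> q * b 0"
  hence less: "q * b 0 < b 1" by simp
  have pos1: "b 1 > 0" using less nonneg[of 0] \<open>0 < q\<close> by (meson le_less_trans less_imp_le mult_nonneg_nonneg)
  have pos0: "b 0 > 0"
  proof (rule ccontr)
    assume "\<not> b 0 > 0"
    hence "b 0 = 0" using nonneg[of 0] by simp
    with convex[of 0] pos1 show False by simp
  qed
  define r where "r = b 1 / b 0"
  have r: "q < r" using less pos0 by (simp add: r_def pos_less_divide_eq)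
  hence r0: "r > 0" using \<open>0 < q\<close> by simp
  have ratio: "0 < b k \<and> r * b k \<le> b (Suc k)" for k
  proof (induction k)
    case 0
    show ?case using pos0 by (simp add: r_def)
  next
    case (Suc k)
    hence pos: "0 < b (Suc k)" using r0 by (meson less_le_trans mult_pos_pos)
    have "r * b k * b (Suc k) \<le> (b (Suc k))\<^sup>2"
      using Suc pos by (simp add: power2_eq_square)
    also have "\<dots> \<le> b k * b (Suc (Suc k))" by (rule convex)
    finally have "b k * (r * b (Suc k)) \<le> b k * b (Suc (Suc k))" by (simp add: algebra_simps)
    hence "r * b (Suc k) \<le> b (Suc (Suc k))" using Suc by (simp del: mult.commute)
    thus ?case using pos by simp
  qed
  have growth: "r ^ k * b 0 \<le> b k" for k
  proof (induction k)
    case (Suc k)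
    have "r ^ Suc k * b 0 = r * (r ^ k * b 0)" by simp
    also have "\<dots> \<le> r * b k" using Suc r0 by simp
    also have "\<dots> \<le> b (Suc k)" using ratio by simp
    finally show ?case .
  qed simp
  have "r / q > 1" using r \<open>0 < q\<close> by simp
  then obtain k where k: "C / b 0 < (r / q) ^ k" using real_arch_pow by blast
  have "C * q ^ k < r ^ k * b 0"
    using k pos0 \<open>0 < q\<close> by (simp add: power_divide field_simps)
  with growth[of k] bound[of k] show False by linarith
qed

text \<open>The weights are not normalized: the inequalities wanted are homogeneous in
  \<open>w\<close>, so the normalization of \<nu> enters only at the very end.\<close>

definition weighted_inner :: "'a set \<Rightarrow> ('a \<Rightarrow> real) \<Rightarrow> ('a \<Rightarrow> real) \<Rightarrow> ('a \<Rightarrow> real) \<Rightarrow> real" where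
  "weighted_inner X w f g = (\<Sum>x\<in>X. w x * f x * g x)"

lemma weighted_inner_commute: "weighted_inner X w f g = weighted_inner X w g f"
  by (simp add: weighted_inner_def mult_ac)

lemma weighted_inner_add_right:
  "weighted_inner X w f (\<lambda>x. g x + h x) = weighted_inner X w f g + weighted_inner X w f h"
  by (simp add: weighted_inner_def algebra_simps sum.distrib)

lemma weighted_inner_Cauchy_Schwarz:
  assumes "\<And>x. x \<in> X \<Longrightarrow> 0 \<le> w x"
  shows "(weighted_inner X w f g)\<^sup>2 \<le> weighted_inner X w f f * weighted_inner X w g g"
proof -
  have "(weighted_inner X w f g)\<^sup>2 = (\<Sum>x\<in>X. (sqrt (w x) * f x) * (sqrt (w x) * g x))\<^sup>2"
    unfolding weighted_inner_def
    by (rule arg_cong[of _ _ "\<lambda>x. x\<^sup>2"], rule sum.cong) (use assms in \<open>auto simp: algebra_simps\<close>)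
  also have "\<dots> \<le> (\<Sum>x\<in>X. (sqrt (w x) * f x)\<^sup>2) * (\<Sum>x\<in>X. (sqrt (w x) * g x)\<^sup>2)"
    by (rule Cauchy_Schwarz_ineq_sum)
  also have "\<dots> = weighted_inner X w f f * weighted_inner X w g g"
    unfolding weighted_inner_def using assms
    by (intro arg_cong2[of _ _ _ _ "(*)"] sum.cong) (auto simp: power_mult_distrib power2_eq_square algebra_simps)
  finally show ?thesis .
qed

text \<open>For a self-adjoint operator the squared norms of the iterates are log-convex, so that any
  exponential rate of decay already holds in the first step.\<close>

lemma weighted_inner_contraction:
  fixes T :: "('a \<Rightarrow> real) \<Rightarrow> 'a \<Rightarrow> real" and f :: "'a \<Rightarrow> real"
  defines "g \<equiv> \<lambda>k. (T ^^ k) f"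
  assumes w: "\<And>x. x \<in> X \<Longrightarrow> 0 \<le> w x"
    and sym: "\<And>u v. weighted_inner X w u (T v) = weighted_inner X w (T u) v"
    and bound: "\<And>k. weighted_inner X w (g k) (g k) \<le> C * (\<theta>\<^sup>2) ^ k" and "0 < \<theta>"
  shows "weighted_inner X w f (T f) \<le> \<theta> * weighted_inner X w f f"
proof -
  let ?ip = "weighted_inner X w"
  have nonneg: "0 \<le> ?ip u u" for u
    unfolding weighted_inner_def by (intro sum_nonneg) (use w in \<open>auto simp: mult.assoc\<close>)
  \<comment> \<open>Moving one \<open>T\<close> across the inner product compares the iterates k and
    k + 2; Cauchy-Schwarz then gives log-convexity.\<close>
  have "(?ip (g (Suc k)) (g (Suc k)))\<^sup>2 \<le> ?ip (g k) (g k) * ?ip (g (Suc (Suc k))) (g (Suc (Suc k)))" for k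
  proof -
    have "?ip (g (Suc k)) (g (Suc k)) = ?ip (g k) (g (Suc (Suc k)))"
      using sym[of "g k" "g (Suc k)"] by (simp add: g_def)
    thus ?thesis using weighted_inner_Cauchy_Schwarz[of X w "g k" "g (Suc (Suc k))"] w by simp
  qed
  hence "?ip (g 1) (g 1) \<le> \<theta>\<^sup>2 * ?ip (g 0) (g 0)"
    by (rule log_convex_decay[OF nonneg _ bound]) (use \<open>0 < \<theta>\<close> in auto)
  hence "?ip (T f) (T f) \<le> \<theta>\<^sup>2 * ?ip f f" by (simp add: g_def)
  moreover have "(?ip f (T f))\<^sup>2 \<le> ?ip f f * ?ip (T f) (T f)"
    by (rule weighted_inner_Cauchy_Schwarz[OF w])
  ultimately have "(?ip f (T f))\<^sup>2 \<le> ?ip f f * (\<theta>\<^sup>2 * ?ip f f)"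
    using nonneg[of f] by (meson mult_left_mono order_trans)
  also have "\<dots> = (\<theta> * ?ip f f)\<^sup>2" by (simp add: power2_eq_square)
  finally show ?thesis
    by (rule power2_le_imp_le) (use nonneg \<open>0 < \<theta>\<close> in simp)
qed

section \<open>Random transpositions\<close>

text \<open>For the uniform measure on a set closed under permutations of \<open>V\<close>, this is
  the conditional expectation given the orbit: as \<pi> varies, each element of the orbit of \<eta>
  is hit equally often.\<close>

definition perm_average :: "'a set \<Rightarrow> (('a \<Rightarrow> 'b) \<Rightarrow> real) \<Rightarrow> ('a \<Rightarrow> 'b) \<Rightarrow> real" where
  "perm_average V f \<eta> = (\<Sum>\<pi> | \<pi> permutes V. f (\<eta> \<circ> \<pi>)) / fact (card V)"

definition perm_closed :: "'a set \<Rightarrow> ('a \<Rightarrow> 'b) set \<Rightarrow> bool" where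
  "perm_closed V X \<longleftrightarrow> (\<forall>\<eta>\<in>X. \<forall>\<pi>. \<pi> permutes V \<longrightarrow> \<eta> \<circ> \<pi> \<in> X)"

lemma perm_closedD: "perm_closed V X \<Longrightarrow> \<eta> \<in> X \<Longrightarrow> \<pi> permutes V \<Longrightarrow> \<eta> \<circ> \<pi> \<in> X"
  by (simp add: perm_closed_def)

lemma perm_closed_swap:
  "perm_closed V X \<Longrightarrow> \<eta> \<in> X \<Longrightarrow> i \<in> V \<Longrightarrow> j \<in> V \<Longrightarrow> swap \<eta> i j \<in> X"
  by (simp add: perm_closed_def permutes_swap_id)

lemma perm_closed_subset: "perm_closed V X \<Longrightarrow> U \<subseteq> V \<Longrightarrow> perm_closed U X"
  unfolding perm_closed_def by (meson permutes_subset)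

lemma sum_comp_permutes:
  assumes "perm_closed V X" "\<pi> permutes V"
  shows "(\<Sum>\<eta>\<in>X. g (\<eta> \<circ> \<pi>)) = (\<Sum>\<eta>\<in>X. g \<eta>)"
  by (rule sum.reindex_bij_witness[where i = "\<lambda>\<eta>. \<eta> \<circ> inv \<pi>" and j = "\<lambda>\<eta>. \<eta> \<circ> \<pi>"])
     (use assms permutes_inv[OF assms(2)] in
       \<open>auto simp: perm_closedD o_assoc[symmetric] permutes_inv_o[OF assms(2)]\<close>)

lemma sum_comp_swap:
  assumes "perm_closed V X" "i \<in> V" "j \<in> V"
  shows "(\<Sum>\<eta>\<in>X. g (swap \<eta> i j)) = (\<Sum>\<eta>\<in>X. g \<eta>)"
  by (rule sum_comp_permutes[OF assms(1)]) (simp add: assms permutes_swap_id)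

lemma perm_average_invariant:
  assumes "\<pi> permutes V"
  shows "perm_average V f (\<eta> \<circ> \<pi>) = perm_average V f \<eta>"
  using setum_permutations_compose_left[OF assms, of "\<lambda>\<sigma>. f (\<eta> \<circ> \<sigma>)"]
  by (simp add: perm_average_def o_assoc)

text \<open>The defining property of a conditional expectation, tested against an invariant function
  \<open>u\<close>. It supplies the orthogonality in Pythagoras.\<close>

lemma sum_perm_average_mult:
  assumes X: "perm_closed V X" and V: "finite V"
    and u: "\<And>\<eta> \<pi>. \<eta> \<in> X \<Longrightarrow> \<pi> permutes V \<Longrightarrow> u (\<eta> \<circ> \<pi>) = u \<eta>"
  shows "(\<Sum>\<eta>\<in>X. perm_average V f \<eta> * u \<eta>) = (\<Sum>\<eta>\<in>X. f \<eta> * u \<eta>)"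
proof -
  have "(\<Sum>\<eta>\<in>X. perm_average V f \<eta> * u \<eta>)
      = (\<Sum>\<eta>\<in>X. \<Sum>\<pi> | \<pi> permutes V. f (\<eta> \<circ> \<pi>) * u (\<eta> \<circ> \<pi>)) / fact (card V)"
    by (simp add: perm_average_def sum_divide_distrib sum_distrib_right u)
  also have "\<dots> = (\<Sum>\<pi> | \<pi> permutes V. \<Sum>\<eta>\<in>X. f (\<eta> \<circ> \<pi>) * u (\<eta> \<circ> \<pi>)) / fact (card V)"
    by (subst sum.swap) (rule refl)
  also have "\<dots> = (\<Sum>\<pi> | \<pi> permutes V. \<Sum>\<eta>\<in>X. f \<eta> * u \<eta>) / fact (card V)"
    using sum_comp_permutes[OF X, of _ "\<lambda>\<eta>. f \<eta> * u \<eta>"] by simp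
  also have "\<dots> = (\<Sum>\<eta>\<in>X. f \<eta> * u \<eta>)"
    by (simp add: card_permutations[OF refl V])
  finally show ?thesis .
qed

text \<open>Every permutation of \<open>insert k V\<close> is uniquely a transposition of k with
  some l combined with a permutation of \<open>V\<close>. The difference of the two averages is
  therefore a mean of increments of f under such transpositions, and its square is at most the mean
  of their squares.\<close>

lemma perm_average_step:
  assumes X: "perm_closed (insert k V) X" and V: "finite V" "k \<notin> V"
  shows "(\<Sum>\<eta>\<in>X. (perm_average V f \<eta> - perm_average (insert k V) f \<eta>)\<^sup>2)
      \<le> (\<Sum>l\<in>insert k V. \<Sum>\<eta>\<in>X. (f (swap \<eta> k l) - f \<eta>)\<^sup>2) / real (card (insert k V))"
proof -
  let ?W = "insert k V" and ?P = "{\<pi>. \<pi> permutes V}"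
  let ?M = "fact (card V) * real (card ?W)"
  define d where "d \<eta> l = f (swap \<eta> k l) - f \<eta>" for \<eta> l
  have fact: "fact (card ?W) = ?M" using V by (simp add: mult.commute)
  have pos: "real (card ?W) > 0" using V by (simp add: card_gt_0_iff)
  have cards: "real (card (?W \<times> ?P)) = ?M"
    using V by (simp add: card_cartesian_product card_permutations[OF refl V(1)] algebra_simps)
  have diff: "perm_average ?W f \<eta> - perm_average V f \<eta>
      = (\<Sum>(l, \<pi>)\<in>?W \<times> ?P. d (\<eta> \<circ> inv \<pi>) l) / ?M" for \<eta>
  proof -
    \<comment> \<open>Passing to inverses puts the transposition next to the argument, so that it
      acts as an exchange on the permuted configuration
      \<open>\<eta> \<circ> inv \<pi>\<close>.\<close>
    have "(\<Sum>\<pi> | \<pi> permutes ?W. f (\<eta> \<circ> \<pi>)) = (\<Sum>\<pi> | \<pi> permutes ?W. f (\<eta> \<circ> inv \<pi>))"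
      by (rule sum_permutations_inverse)
    also have "\<dots> = (\<Sum>l\<in>?W. \<Sum>\<pi>\<in>?P. f (\<eta> \<circ> inv (Transposition.transpose k l \<circ> \<pi>)))"
      by (rule sum_over_permutations_insert[OF V])
    also have "\<dots> = (\<Sum>l\<in>?W. \<Sum>\<pi>\<in>?P. f (swap (\<eta> \<circ> inv \<pi>) k l))"
    proof (intro sum.cong refl)
      fix l \<pi> assume "\<pi> \<in> ?P"
      hence "bij \<pi>" by (simp add: permutes_bij)
      thus "f (\<eta> \<circ> inv (Transposition.transpose k l \<circ> \<pi>)) = f (swap (\<eta> \<circ> inv \<pi>) k l)"
        by (simp add: o_inv_distrib o_assoc)
    qed
    finally have 1: "perm_average ?W f \<eta> = (\<Sum>l\<in>?W. \<Sum>\<pi>\<in>?P. f (swap (\<eta> \<circ> inv \<pi>) k l)) / ?M"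
      by (simp only: perm_average_def fact)
    have "(\<Sum>\<pi>\<in>?P. f (\<eta> \<circ> \<pi>)) = (\<Sum>\<pi>\<in>?P. f (\<eta> \<circ> inv \<pi>))"
      by (rule sum_permutations_inverse)
    hence 2: "perm_average V f \<eta> = (\<Sum>l\<in>?W. \<Sum>\<pi>\<in>?P. f (\<eta> \<circ> inv \<pi>)) / ?M"
      using pos by (simp add: perm_average_def)
    show ?thesis
      unfolding 1 2 d_def by (simp add: sum.cartesian_product[symmetric] sum_subtractf diff_divide_distrib)
  qed
  have Mpos: "?M > 0" using pos by simp
  have "(perm_average V f \<eta> - perm_average ?W f \<eta>)\<^sup>2
      \<le> (\<Sum>(l, \<pi>)\<in>?W \<times> ?P. (d (\<eta> \<circ> inv \<pi>) l)\<^sup>2) / ?M" for \<eta>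
  proof -
    have "(perm_average V f \<eta> - perm_average ?W f \<eta>)\<^sup>2
        = (\<Sum>x\<in>?W \<times> ?P. case x of (l, \<pi>) \<Rightarrow> d (\<eta> \<circ> inv \<pi>) l)\<^sup>2 / ?M\<^sup>2"
      by (subst power2_commute) (simp only: diff power_divide)
    also have "\<dots> \<le> ((\<Sum>x\<in>?W \<times> ?P. (case x of (l, \<pi>) \<Rightarrow> d (\<eta> \<circ> inv \<pi>) l)\<^sup>2) * ?M) / ?M\<^sup>2"
      unfolding cards[symmetric] by (intro divide_right_mono sum_squared_le_sum_of_squares) simp
    also have "\<dots> = (\<Sum>(l, \<pi>)\<in>?W \<times> ?P. (d (\<eta> \<circ> inv \<pi>) l)\<^sup>2) / ?M"
      using Mpos by (simp add: power2_eq_square case_prod_beta)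
    finally show ?thesis .
  qed
  hence "(\<Sum>\<eta>\<in>X. (perm_average V f \<eta> - perm_average ?W f \<eta>)\<^sup>2)
      \<le> (\<Sum>\<eta>\<in>X. (\<Sum>(l, \<pi>)\<in>?W \<times> ?P. (d (\<eta> \<circ> inv \<pi>) l)\<^sup>2) / ?M)"
    by (rule sum_mono)
  also have "\<dots> = (\<Sum>\<eta>\<in>X. \<Sum>(l, \<pi>)\<in>?W \<times> ?P. (d (\<eta> \<circ> inv \<pi>) l)\<^sup>2) / ?M"
    by (simp add: sum_divide_distrib)
  also have "\<dots> = (\<Sum>(l, \<pi>)\<in>?W \<times> ?P. \<Sum>\<eta>\<in>X. (d (\<eta> \<circ> inv \<pi>) l)\<^sup>2) / ?M"
    by (subst sum.swap) (simp add: case_prod_beta)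
  also have "\<dots> = (\<Sum>(l, \<pi>)\<in>?W \<times> ?P. \<Sum>\<eta>\<in>X. (d \<eta> l)\<^sup>2) / ?M"
  proof -
    have "(\<Sum>\<eta>\<in>X. (d (\<eta> \<circ> inv \<pi>) l)\<^sup>2) = (\<Sum>\<eta>\<in>X. (d \<eta> l)\<^sup>2)" if "\<pi> permutes V" for \<pi> l
      by (rule sum_comp_permutes[OF X, of _ "\<lambda>\<eta>. (d \<eta> l)\<^sup>2"])
         (meson permutes_inv permutes_subset subset_insertI that)
    thus ?thesis by (intro arg_cong2[of _ _ _ _ "(/)"] sum.cong) auto
  qed
  also have "\<dots> = (\<Sum>l\<in>?W. \<Sum>\<eta>\<in>X. (d \<eta> l)\<^sup>2) / real (card ?W)"
    using pos by (simp add: sum.cartesian_product[symmetric] card_permutations[OF refl V(1)]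
        sum_distrib_left[symmetric])
  finally show ?thesis by (simp only: d_def)
qed

text \<open>Pythagoras splits off the resampling of one site; averaging over the choice of that site
  and induction on the number of sites give the spectral gap of random transpositions, up to a
  constant factor.\<close>

lemma random_transposition_gap:
  assumes "finite V" "perm_closed V X"
  shows "real (card V) * (\<Sum>\<eta>\<in>X. (f \<eta> - perm_average V f \<eta>)\<^sup>2)
      \<le> (\<Sum>k\<in>V. \<Sum>l\<in>V. \<Sum>\<eta>\<in>X. (f (swap \<eta> k l) - f \<eta>)\<^sup>2)"
  using assms
proof (induction "card V" arbitrary: V rule: less_induct)
  case less
  define e where "e k l = (\<Sum>\<eta>\<in>X. (f (swap \<eta> k l) - f \<eta>)\<^sup>2)" for k l
  define B where "B U = (\<Sum>\<eta>\<in>X. (f \<eta> - perm_average U f \<eta>)\<^sup>2)" for U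
  have e_nonneg: "0 \<le> e k l" for k l by (simp add: e_def sum_nonneg)
  have e_diag: "e k k = 0" for k by (simp add: e_def)
  have e_sym: "e k l = e l k" for k l by (simp add: e_def transpose_commute)
  define S where "S = (\<Sum>k\<in>V. \<Sum>l\<in>V. e k l)"
  have S_nonneg: "0 \<le> S" unfolding S_def by (intro sum_nonneg e_nonneg)
  have "real (card V) * B V \<le> S"
  proof (cases "card V \<le> 1")
    case True
    have "perm_average V f = f" if "card V = 1"
    proof -
      from that obtain a where "V = {a}" by (auto simp: card_1_singleton_iff)
      thus ?thesis by (intro ext) (simp add: perm_average_def)
    qed
    hence "real (card V) * B V = 0"
      using True by (cases "card V") (auto simp: B_def)
    thus ?thesis using S_nonneg by linarith
  next
    case False
    define M where "M = real (card V)"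
    have M: "M \<ge> 2" using False by (simp add: M_def)
    \<comment> \<open>The energy inside \<open>V - {k}\<close> is \<open>S\<close> minus the row and
      the column of k; these are equal by symmetry and meet only on the vanishing diagonal, whence
      the factor 2.\<close>
    have step: "B V \<le> (S - 2 * (\<Sum>l\<in>V. e k l)) / (M - 1) + (\<Sum>l\<in>V. e k l) / M" if k: "k \<in> V" for k
    proof -
      let ?U = "V - {k}"
      have V_eq: "V = insert k ?U" using k by auto
      have fin: "finite ?U" using less.prems by simp
      have cardU: "real (card ?U) = M - 1"
        using k less.prems False by (simp add: M_def of_nat_diff)
      have closedU: "perm_closed ?U X" by (rule perm_closed_subset[OF less.prems(2)]) auto
      have "B V = (\<Sum>\<eta>\<in>X. (f \<eta> - perm_average ?U f \<eta>)\<^sup>2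
            + (perm_average ?U f \<eta> - perm_average V f \<eta>)\<^sup>2
            + 2 * ((f \<eta> - perm_average ?U f \<eta>) * (perm_average ?U f \<eta> - perm_average V f \<eta>)))"
        unfolding B_def by (intro sum.cong refl) (simp add: power2_eq_square algebra_simps)
      also have "\<dots> = B ?U + (\<Sum>\<eta>\<in>X. (perm_average ?U f \<eta> - perm_average V f \<eta>)\<^sup>2)
          + 2 * (\<Sum>\<eta>\<in>X. (f \<eta> - perm_average ?U f \<eta>) * (perm_average ?U f \<eta> - perm_average V f \<eta>))"
        unfolding B_def by (simp add: sum.distrib sum_distrib_left)
      \<comment> \<open>The second factor is invariant under permutations of \<open>?U\<close>, and
        the first has zero average over them.\<close>
      also have "(\<Sum>\<eta>\<in>X. (f \<eta> - perm_average ?U f \<eta>) * (perm_average ?U f \<eta> - perm_average V f \<eta>)) = 0"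
      proof -
        have "(\<Sum>\<eta>\<in>X. perm_average ?U f \<eta> * (perm_average ?U f \<eta> - perm_average V f \<eta>))
            = (\<Sum>\<eta>\<in>X. f \<eta> * (perm_average ?U f \<eta> - perm_average V f \<eta>))"
        proof (rule sum_perm_average_mult[OF closedU fin])
          fix \<eta> :: "'a \<Rightarrow> 'b" and \<pi> assume \<pi>: "\<pi> permutes ?U"
          have "\<pi> permutes V" by (rule permutes_subset[OF \<pi>]) auto
          thus "perm_average ?U f (\<eta> \<circ> \<pi>) - perm_average V f (\<eta> \<circ> \<pi>)
              = perm_average ?U f \<eta> - perm_average V f \<eta>"
            using \<pi> by (simp only: perm_average_invariant)
        qed
        thus ?thesis by (simp add: left_diff_distrib sum_subtractf)
      qed
      also have "(\<Sum>\<eta>\<in>X. (perm_average ?U f \<eta> - perm_average V f \<eta>)\<^sup>2) \<le> (\<Sum>l\<in>V. e k l) / M"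
        using perm_average_step[of k ?U X f] less.prems fin
        unfolding V_eq[symmetric] M_def e_def by simp
      also have "B ?U \<le> (S - 2 * (\<Sum>l\<in>V. e k l)) / (M - 1)"
      proof -
        have lt: "card ?U < card V" by (rule card_Diff1_less[OF less.prems(1) k])
        have "real (card ?U) * B ?U \<le> (\<Sum>i\<in>?U. \<Sum>j\<in>?U. e i j)"
          unfolding B_def e_def by (rule less.hyps[OF lt fin closedU])
        also have "\<dots> = (\<Sum>i\<in>?U. (\<Sum>j\<in>V. e i j) - e i k)"
          by (intro sum.cong refl) (simp add: sum_diff1 less.prems k)
        also have "\<dots> = (\<Sum>i\<in>V. (\<Sum>j\<in>V. e i j) - e i k) - (\<Sum>j\<in>V. e k j)"
          by (simp add: sum_diff1 less.prems k e_diag)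
        also have "\<dots> = S - 2 * (\<Sum>l\<in>V. e k l)"
          by (simp add: S_def sum_subtractf e_sym[of _ k])
        finally show ?thesis using M by (simp add: cardU pos_le_divide_eq mult.commute)
      qed
      finally show ?thesis by simp
    qed
    \<comment> \<open>Averaging over k turns the sum of the rows into \<open>S\<close>. The
      induction closes with constant 1 because
      \<open>(M - 2) / (M - 1) + 1 / M = 1 - 1 / (M * (M - 1))\<close>.\<close>
    have "M * B V = (\<Sum>k\<in>V. B V)" by (simp add: M_def)
    also have "\<dots> \<le> (\<Sum>k\<in>V. (S - 2 * (\<Sum>l\<in>V. e k l)) / (M - 1) + (\<Sum>l\<in>V. e k l) / M)"
      by (rule sum_mono) (rule step)
    also have "\<dots> = (M * S - 2 * S) / (M - 1) + S / M"
      by (simp add: sum.distrib sum_divide_distrib[symmetric] sum_subtractf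
          sum_distrib_left[symmetric] S_def[symmetric] M_def)
    also have "\<dots> = S * ((M - 2) / (M - 1) + 1 / M)" using M by (simp add: field_simps)
    also have "\<dots> \<le> S * 1"
      by (rule mult_left_mono[OF _ S_nonneg]) (use M in \<open>simp add: field_simps\<close>)
    finally show ?thesis by (simp add: M_def)
  qed
  thus ?case by (simp add: B_def S_def e_def)
qed

section \<open>The Dirichlet form\<close>

locale colored_exclusion =
  fixes m N :: nat and p :: "nat \<Rightarrow> real" and \<omega> :: "nat \<Rightarrow> nat" and \<epsilon> :: real
  assumes colors: "1 \<le> m" and eps_pos: "0 < \<epsilon>"
    and p_bounds: "\<And>i. i \<in> {1..N} \<Longrightarrow> \<epsilon> \<le> p i \<and> p i \<le> 1 - \<epsilon>"
    and particles_pos: "0 < (\<Sum>k = 1..m. \<omega> k)" and particles_less: "(\<Sum>k = 1..m. \<omega> k) < N"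
begin

abbreviation "sites \<equiv> {1..N}"
abbreviation "X \<equiv> configs m N \<omega>"
abbreviation "particles \<equiv> \<Sum>k = 1..m. \<omega> k"

text \<open>The single-site law without its factor \<open>1 / Z_i\<close>, which is the same for all
  configurations. All colors have the same weight, so \<open>weight\<close> sees only the occupation
  variables.\<close>

definition site_weight :: "nat \<Rightarrow> nat \<Rightarrow> real" where
  "site_weight i k = (if k = 0 then 1 - p i else p i)"

definition weight :: "(nat \<Rightarrow> nat) \<Rightarrow> real" where
  "weight \<eta> = (\<Prod>i\<in>sites. site_weight i (\<eta> i))"

abbreviation ip :: "((nat \<Rightarrow> nat) \<Rightarrow> real) \<Rightarrow> ((nat \<Rightarrow> nat) \<Rightarrow> real) \<Rightarrow> real" where
  "ip \<equiv> weighted_inner X weight"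

lemma N_ge_2: "2 \<le> N"
  using particles_pos particles_less by linarith

lemma finite_configs: "finite X"
  by (rule finite_subset[of _ "PiE_dflt {1..N} 0 (\<lambda>_. {0..m})"]) (auto simp: configs_def)

lemma config_le: "\<eta> \<in> X \<Longrightarrow> \<eta> i \<le> m"
  by (auto simp: configs_def PiE_dflt_def) (metis le0 not_le)

lemma config_outside: "\<eta> \<in> X \<Longrightarrow> i \<notin> sites \<Longrightarrow> \<eta> i = 0"
  by (auto simp: configs_def PiE_dflt_def)

lemma config_count: "\<eta> \<in> X \<Longrightarrow> k \<in> {1..m} \<Longrightarrow> card {i \<in> sites. \<eta> i = k} = \<omega> k"
  by (auto simp: configs_def of_bool_def sum.If_cases Int_def)

lemma card_occupied:
  assumes "\<eta> \<in> X"
  shows "card {i \<in> sites. \<eta> i \<noteq> 0} = particles"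
proof -
  have "{i \<in> sites. \<eta> i \<noteq> 0} = (\<Union>k\<in>{1..m}. {i \<in> sites. \<eta> i = k})"
    using config_le[OF assms] by (auto simp: Suc_le_eq)
  also have "card \<dots> = (\<Sum>k\<in>{1..m}. card {i \<in> sites. \<eta> i = k})"
    by (rule card_UN_disjoint) auto
  finally show ?thesis using config_count[OF assms] by simp
qed

lemma card_empty:
  assumes "\<eta> \<in> X"
  shows "card {i \<in> sites. \<eta> i = 0} = N - particles"
proof -
  have "{i \<in> sites. \<eta> i = 0} = sites - {i \<in> sites. \<eta> i \<noteq> 0}" by auto
  also have "card \<dots> = N - particles"
    by (subst card_Diff_subset) (auto simp only: card_occupied[OF assms] finite_Collect_conjI finite_atLeastAtMost card_atLeastAtMost diff_Suc_1 Collect_mem_eq)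
  finally show ?thesis .
qed

lemma perm_closed_configs: "perm_closed sites X"
  unfolding perm_closed_def
proof (intro ballI allI impI)
  fix \<eta> \<pi> assume \<eta>: "\<eta> \<in> X" and \<pi>: "\<pi> permutes sites"
  have "(\<Sum>i\<in>sites. of_bool ((\<eta> \<circ> \<pi>) i = k)) = (\<Sum>i\<in>sites. of_bool (\<eta> i = k) :: nat)" for k
    using sum.permute[OF \<pi>, of "\<lambda>i. of_bool (\<eta> i = k) :: nat"] by (simp only: o_def)
  moreover have "(\<eta> \<circ> \<pi>) i \<le> m" for i using config_le[OF \<eta>] by simp
  moreover have "(\<eta> \<circ> \<pi>) i = 0" if "i \<notin> sites" for i
    using that config_outside[OF \<eta>] by (simp add: permutes_not_in[OF \<pi>])
  ultimately show "\<eta> \<circ> \<pi> \<in> X"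
    using \<eta> unfolding configs_def PiE_dflt_def by auto
qed

lemma swap_config: "\<eta> \<in> X \<Longrightarrow> i \<in> sites \<Longrightarrow> j \<in> sites \<Longrightarrow> swap \<eta> i j \<in> X"
  by (rule perm_closed_swap[OF perm_closed_configs])

text \<open>Two configurations with the same number of sites of each color, holes included, have the
  same multiset of values on \<open>A\<close> once they agree elsewhere. With \<open>A\<close> all
  sites this connects \<open>X\<close> by exchanges; with \<open>A\<close> the occupied sites it
  makes the colorings of a given occupation a single orbit.\<close>

lemma configs_transitive:
  assumes "\<eta> \<in> X" "\<zeta> \<in> X" "A \<subseteq> sites" and eq: "\<And>i. i \<notin> A \<Longrightarrow> \<eta> i = \<zeta> i"
  obtains \<pi> where "\<pi> permutes A" "\<eta> = \<zeta> \<circ> \<pi>"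
proof -
  have fin: "finite A" using assms(3) finite_subset by blast
  have "card {i \<in> A. \<eta> i = k} = card {i \<in> A. \<zeta> i = k}" for k
  proof -
    have all: "card {i \<in> sites. \<eta> i = k} = card {i \<in> sites. \<zeta> i = k}"
    proof (cases "k \<in> {1..m}")
      case True
      thus ?thesis using assms config_count by simp
    next
      case False
      hence "k = 0 \<or> k > m" by auto
      thus ?thesis
      proof
        assume "k > m"
        hence "{i \<in> sites. \<eta> i = k} = {}" "{i \<in> sites. \<zeta> i = k} = {}"
          using config_le[OF assms(1)] config_le[OF assms(2)] by (auto simp: not_le[symmetric])
        thus ?thesis by (simp only:)
      qed (simp only: card_empty assms)
    qed
    have split: "card {i \<in> sites. \<xi> i = k} = card {i \<in> A. \<xi> i = k} + card {i \<in> sites - A. \<xi> i = k}" for \<xi>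
    proof -
      have "{i \<in> sites. \<xi> i = k} = {i \<in> A. \<xi> i = k} \<union> {i \<in> sites - A. \<xi> i = k}"
        using assms(3) by auto
      thus ?thesis using fin by (simp only:) (rule card_Un_disjoint, auto)
    qed
    have "{i \<in> sites - A. \<eta> i = k} = {i \<in> sites - A. \<zeta> i = k}" using eq by auto
    with all split[of \<eta>] split[of \<zeta>] show ?thesis by simp
  qed
  moreover have "count (image_mset \<xi> (mset_set A)) k = card {i \<in> A. \<xi> i = k}" for \<xi> :: "nat \<Rightarrow> nat" and k
  proof -
    have "count (image_mset \<xi> (mset_set A)) k = (\<Sum>x | x \<in> A \<and> k = \<xi> x. count (mset_set A) x)"
      using fin by (simp add: count_image_mset')
    also have "\<dots> = (\<Sum>x | x \<in> A \<and> k = \<xi> x. 1)"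
      by (intro sum.cong refl) (use fin in simp)
    also have "{x. x \<in> A \<and> k = \<xi> x} = {i \<in> A. \<xi> i = k}" by auto
    finally show ?thesis by simp
  qed
  ultimately have "image_mset \<eta> (mset_set A) = image_mset \<zeta> (mset_set A)"
    by (intro multiset_eqI) (simp only:)
  from image_mset_eq_implies_permutes[OF fin this]
  obtain \<pi> where \<pi>: "\<pi> permutes A" "\<forall>x\<in>A. \<eta> x = \<zeta> (\<pi> x)" by auto
  have "\<eta> = \<zeta> \<circ> \<pi>"
  proof
    fix x show "\<eta> x = (\<zeta> \<circ> \<pi>) x"
      using \<pi> eq[of x] by (cases "x \<in> A") (auto simp: permutes_not_in)
  qed
  with \<pi> that show ?thesis by blast
qed

section \<open>Weights, jump rates and reversibility\<close>

lemma p_pos: "i \<in> sites \<Longrightarrow> 0 < p i" and p_less: "i \<in> sites \<Longrightarrow> p i < 1"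
  using p_bounds[of i] eps_pos by linarith+

lemma site_weight_ge: "i \<in> sites \<Longrightarrow> \<epsilon> \<le> site_weight i k"
  and site_weight_le: "i \<in> sites \<Longrightarrow> site_weight i k \<le> 1"
  using p_bounds[of i] eps_pos by (auto simp: site_weight_def)

lemma eps_less: "\<epsilon> < 1"
  using p_bounds[of 1] N_ge_2 eps_pos by auto

lemma site_weight_pos: "i \<in> sites \<Longrightarrow> 0 < site_weight i k"
  using site_weight_ge[of i k] eps_pos by linarith

lemma weight_pos: "0 < weight \<eta>"
  unfolding weight_def by (intro prod_pos) (use site_weight_pos in auto)

lemma weight_nonneg: "0 \<le> weight \<eta>"
  using weight_pos[of \<eta>] by simp

lemma weight_cong:
  assumes "\<And>i. \<eta> i = 0 \<longleftrightarrow> \<zeta> i = 0"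
  shows "weight \<eta> = weight \<zeta>"
  unfolding weight_def site_weight_def using assms by simp

lemma weight_split:
  assumes "i \<in> sites" "j \<in> sites" "i \<noteq> j"
  shows "weight \<eta> = site_weight i (\<eta> i) * site_weight j (\<eta> j) * (\<Prod>k\<in>sites - {i, j}. site_weight k (\<eta> k))"
proof -
  have "sites = insert i (insert j (sites - {i, j}))" using assms by auto
  thus ?thesis unfolding weight_def
    by (metis (no_types, lifting) Diff_iff assms(3) finite_Diff finite_atLeastAtMost finite_insert insert_iff mult.assoc prod.insert)
qed

lemma weight_swap_split:
  assumes "i \<in> sites" "j \<in> sites" "i \<noteq> j"
  shows "weight (swap \<eta> i j) = site_weight i (\<eta> j) * site_weight j (\<eta> i) * (\<Prod>k\<in>sites - {i, j}. site_weight k (\<eta> k))"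
proof -
  have "(\<Prod>k\<in>sites - {i, j}. site_weight k (swap \<eta> i j k)) = (\<Prod>k\<in>sites - {i, j}. site_weight k (\<eta> k))"
    by (intro prod.cong refl) (auto simp: transpose_apply_other)
  thus ?thesis by (simp add: weight_split[OF assms])
qed

text \<open>Only the factors at i and j change, and each lies between \<epsilon> and 1.\<close>

lemma weight_swap_ge:
  assumes "i \<in> sites" "j \<in> sites"
  shows "\<epsilon>\<^sup>2 * weight \<eta> \<le> weight (swap \<eta> i j)"
proof (cases "i = j")
  case True
  have "\<epsilon>\<^sup>2 \<le> 1" using eps_pos eps_less by (simp add: power_le_one)
  thus ?thesis using True weight_nonneg[of \<eta>] by (simp add: mult_left_le_one_le)
next
  case False
  let ?R = "\<Prod>k\<in>sites - {i, j}. site_weight k (\<eta> k)"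
  have R: "0 \<le> ?R" by (intro prod_nonneg) (use site_weight_pos less_imp_le in auto)
  have "site_weight i (\<eta> i) * site_weight j (\<eta> j) \<le> 1 * 1"
    by (intro mult_mono site_weight_le less_imp_le[OF site_weight_pos] assms) simp
  hence 1: "weight \<eta> \<le> ?R"
    unfolding weight_split[OF assms False] using R mult_right_mono by fastforce
  have "\<epsilon> * \<epsilon> \<le> site_weight i (\<eta> j) * site_weight j (\<eta> i)"
    by (intro mult_mono site_weight_ge less_imp_le[OF site_weight_pos] less_imp_le[OF eps_pos] assms)
  hence 2: "\<epsilon>\<^sup>2 * ?R \<le> weight (swap \<eta> i j)"
    unfolding weight_swap_split[OF assms False] using R by (simp add: power2_eq_square mult_right_mono)
  show ?thesis using mult_left_mono[OF 1, of "\<epsilon>\<^sup>2"] 2 by simp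
qed

lemma rate_denominator_pos:
  assumes "i \<in> sites" "j \<in> sites"
  shows "0 < p i * (1 - p j) + p j * (1 - p i)"
  using p_pos[OF assms(1)] p_pos[OF assms(2)] p_less[OF assms(1)] p_less[OF assms(2)]
  by (intro add_pos_pos mult_pos_pos) auto

lemma base_rate_blocked: "(\<eta> i = 0 \<longleftrightarrow> \<eta> j = 0) \<Longrightarrow> base_rate p i j (occ \<eta>) = 0"
  by (cases "\<eta> i = 0") (auto simp: base_rate_def occ_def)

lemma base_rate_empty_occupied:
  "\<eta> i = 0 \<Longrightarrow> \<eta> j \<noteq> 0 \<Longrightarrow> base_rate p i j (occ \<eta>) = p i * (1 - p j) / (p i * (1 - p j) + p j * (1 - p i))"
  by (auto simp: base_rate_def occ_def)

lemma base_rate_occupied_empty: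
  "\<eta> i \<noteq> 0 \<Longrightarrow> \<eta> j = 0 \<Longrightarrow> base_rate p i j (occ \<eta>) = p j * (1 - p i) / (p i * (1 - p j) + p j * (1 - p i))"
  by (auto simp: base_rate_def occ_def)

lemma base_rate_cong:
  assumes "\<eta> i = 0 \<longleftrightarrow> \<zeta> i = 0" "\<eta> j = 0 \<longleftrightarrow> \<zeta> j = 0"
  shows "base_rate p i j (occ \<eta>) = base_rate p i j (occ \<zeta>)"
proof -
  have "occ \<eta> i = occ \<zeta> i" "occ \<eta> j = occ \<zeta> j" using assms by (auto simp: occ_def Suc_le_eq)
  thus ?thesis by (simp add: base_rate_def)
qed

lemma base_rate_commute: "base_rate p i j \<psi> = base_rate p j i \<psi>"
  by (simp add: base_rate_def add.commute)

lemma base_rate_bounds: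
  assumes "i \<in> sites" "j \<in> sites"
  shows "0 \<le> base_rate p i j (occ \<eta>)" "base_rate p i j (occ \<eta>) \<le> 1"
proof -
  note pp = p_pos[OF assms(1)] p_pos[OF assms(2)] p_less[OF assms(1)] p_less[OF assms(2)]
  note d = rate_denominator_pos[OF assms]
  consider "\<eta> i = 0 \<longleftrightarrow> \<eta> j = 0" | "\<eta> i = 0" "\<eta> j \<noteq> 0" | "\<eta> i \<noteq> 0" "\<eta> j = 0" by blast
  hence "0 \<le> base_rate p i j (occ \<eta>) \<and> base_rate p i j (occ \<eta>) \<le> 1"
    by cases (use pp d in \<open>auto simp: base_rate_blocked base_rate_empty_occupied base_rate_occupied_empty divide_le_eq_1\<close>)
  thus "0 \<le> base_rate p i j (occ \<eta>)" "base_rate p i j (occ \<eta>) \<le> 1" by auto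
qed

text \<open>The denominator is the probability that exactly one of two independent sites is
  occupied, hence at most 1, and each possible numerator is a product of two factors at least
  \<epsilon>.\<close>

lemma base_rate_ge:
  assumes "i \<in> sites" "j \<in> sites" "(\<eta> i = 0) \<noteq> (\<eta> j = 0)"
  shows "\<epsilon>\<^sup>2 \<le> base_rate p i j (occ \<eta>)"
proof -
  have main: "\<epsilon>\<^sup>2 \<le> p i * (1 - p j) / (p i * (1 - p j) + p j * (1 - p i))" if "i \<in> sites" "j \<in> sites" for i j
  proof -
    have "p i * (1 - p j) + p j * (1 - p i) = 1 - (p i * p j + (1 - p i) * (1 - p j))"
      by (simp add: algebra_simps)
    also have "\<dots> \<le> 1 - 0"
      using p_pos[OF that(1)] p_pos[OF that(2)] p_less[OF that(1)] p_less[OF that(2)]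
      by (intro diff_left_mono add_nonneg_nonneg mult_nonneg_nonneg) auto
    finally have d: "p i * (1 - p j) + p j * (1 - p i) \<le> 1" by simp
    have "\<epsilon> * \<epsilon> \<le> p i * (1 - p j)"
      by (intro mult_mono) (use that p_bounds[of i] p_bounds[of j] eps_pos in auto)
    moreover have "\<epsilon>\<^sup>2 * (p i * (1 - p j) + p j * (1 - p i)) \<le> \<epsilon>\<^sup>2 * 1"
      by (rule mult_left_mono[OF d]) simp
    ultimately show ?thesis
      using rate_denominator_pos[OF that] by (simp add: pos_le_divide_eq power2_eq_square)
  qed
  show ?thesis
    using main[OF assms(1,2)] main[OF assms(2,1)] assms(3)
    by (cases "\<eta> i = 0") (auto simp: base_rate_empty_occupied base_rate_occupied_empty add.commute)
qed

text \<open>Each rate is the conditional probability of the arrangement reached by the exchange,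
  given one particle on the pair.\<close>

lemma base_rate_heat_bath:
  assumes "i \<in> sites" "j \<in> sites" "\<eta> i \<noteq> 0" "\<eta> j = 0"
  shows "base_rate p i j (occ \<eta>) + base_rate p i j (occ (swap \<eta> i j)) = 1"
  using rate_denominator_pos[OF assms(1,2)] assms
  by (simp add: base_rate_empty_occupied base_rate_occupied_empty add_divide_distrib[symmetric] add.commute)

lemma rate_zero: "rate 0 p i j \<eta> = base_rate p i j (occ \<eta>)"
  by (simp add: rate_def)

lemma rate_nonneg: "0 \<le> \<gamma> \<Longrightarrow> i \<in> sites \<Longrightarrow> j \<in> sites \<Longrightarrow> 0 \<le> rate \<gamma> p i j \<eta>"
  by (simp add: rate_def base_rate_bounds)

text \<open>For a jump, weight times rate contains the symmetric product of all four numbers p and 1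
  - p at the two sites. Between equally occupied sites neither the weight nor the rate
  changes.\<close>

lemma detailed_balance:
  assumes "i \<in> sites" "j \<in> sites"
  shows "weight (swap \<eta> i j) * rate \<gamma> p i j (swap \<eta> i j) = weight \<eta> * rate \<gamma> p i j \<eta>"
proof (cases "i = j")
  case False
  let ?R = "\<Prod>k\<in>sites - {i, j}. site_weight k (\<eta> k)"
  have "(occ (swap \<eta> i j) i = occ (swap \<eta> i j) j) = (occ \<eta> i = occ \<eta> j)" by (auto simp: occ_def)
  moreover have "weight (swap \<eta> i j) = weight \<eta>" if "occ \<eta> i = occ \<eta> j"
  proof (rule weight_cong)
    fix k
    have "\<eta> i = 0 \<longleftrightarrow> \<eta> j = 0" using that by (auto simp: occ_def Suc_le_eq split: if_splits)
    thus "swap \<eta> i j k = 0 \<longleftrightarrow> \<eta> k = 0" by (rule swap_empty_iff)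
  qed
  moreover have "weight (swap \<eta> i j) * base_rate p i j (occ (swap \<eta> i j)) = weight \<eta> * base_rate p i j (occ \<eta>)"
  proof -
    consider "\<eta> i = 0 \<longleftrightarrow> \<eta> j = 0" | "\<eta> i = 0" "\<eta> j \<noteq> 0" | "\<eta> i \<noteq> 0" "\<eta> j = 0" by blast
    thus ?thesis
      by cases (auto simp: weight_split[OF assms False] weight_swap_split[OF assms False] site_weight_def
          base_rate_blocked base_rate_empty_occupied base_rate_occupied_empty)
  qed
  ultimately show ?thesis by (auto simp: rate_def algebra_simps)
qed simp

text \<open>The sum is over ordered pairs, whence the factor 2; the diagonal does not contribute.\<close>

definition gen :: "real \<Rightarrow> ((nat \<Rightarrow> nat) \<Rightarrow> real) \<Rightarrow> (nat \<Rightarrow> nat) \<Rightarrow> real" where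
  "gen \<gamma> f \<eta> = (\<Sum>i\<in>sites. \<Sum>j\<in>sites. rate \<gamma> p i j \<eta> * (f (swap \<eta> i j) - f \<eta>)) / (2 * real N)"

lemma generator_eq_gen: "generator \<gamma> N p f \<eta> = gen \<gamma> f \<eta>"
proof -
  have "(\<Sum>i = 1..N. \<Sum>j = 1..N. rate \<gamma> p i j \<eta> * (f (swap \<eta> i j) - f \<eta>))
      = 2 * (\<Sum>(i, j) \<in> {(i, j). 1 \<le> i \<and> i < j \<and> j \<le> N}. rate \<gamma> p i j \<eta> * (f (swap \<eta> i j) - f \<eta>))"
    by (rule sum_pairs_eq_sum_less) (simp_all add: rate_commute transpose_commute)
  thus ?thesis by (simp add: generator_def gen_def)
qed

text \<open>The denominator combines the 2 for ordered pairs with the 2 from symmetrizing the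
  bilinear form.\<close>

definition dirichlet :: "real \<Rightarrow> ((nat \<Rightarrow> nat) \<Rightarrow> real) \<Rightarrow> ((nat \<Rightarrow> nat) \<Rightarrow> real) \<Rightarrow> real" where
  "dirichlet \<gamma> f g = (\<Sum>i\<in>sites. \<Sum>j\<in>sites. \<Sum>\<eta>\<in>X. weight \<eta> * rate \<gamma> p i j \<eta> *
     ((f (swap \<eta> i j) - f \<eta>) * (g (swap \<eta> i j) - g \<eta>))) / (4 * real N)"

lemma dirichlet_commute: "dirichlet \<gamma> f g = dirichlet \<gamma> g f"
  unfolding dirichlet_def by (intro arg_cong2[of _ _ _ _ "(/)"] sum.cong refl) (simp only: mult.commute)

text \<open>Replacing \<eta> by its exchange in the sum for one pair leaves weight times rate
  unchanged by \<open>detailed_balance\<close>; the mean of the two versions is the symmetric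
  form.\<close>

lemma inner_gen: "ip f (gen \<gamma> g) = - dirichlet \<gamma> f g"
proof -
  have edge: "2 * (\<Sum>\<eta>\<in>X. weight \<eta> * rate \<gamma> p i j \<eta> * (f \<eta> * (g (swap \<eta> i j) - g \<eta>)))
      = - (\<Sum>\<eta>\<in>X. weight \<eta> * rate \<gamma> p i j \<eta> * ((f (swap \<eta> i j) - f \<eta>) * (g (swap \<eta> i j) - g \<eta>)))"
    if ij: "i \<in> sites" "j \<in> sites" for i j
  proof -
    let ?h = "\<lambda>\<eta>. weight \<eta> * rate \<gamma> p i j \<eta> * (f \<eta> * (g (swap \<eta> i j) - g \<eta>))"
    have "?h (swap \<eta> i j) = weight \<eta> * rate \<gamma> p i j \<eta> * (f (swap \<eta> i j) * (g \<eta> - g (swap \<eta> i j)))" for \<eta>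
      by (simp add: detailed_balance[OF ij] o_assoc[symmetric])
    hence "(\<Sum>\<eta>\<in>X. ?h \<eta>) = (\<Sum>\<eta>\<in>X. weight \<eta> * rate \<gamma> p i j \<eta> * (f (swap \<eta> i j) * (g \<eta> - g (swap \<eta> i j))))"
      using sum_comp_swap[OF perm_closed_configs ij, of ?h] by (simp only:)
    hence "2 * (\<Sum>\<eta>\<in>X. ?h \<eta>) = (\<Sum>\<eta>\<in>X. ?h \<eta>) + (\<Sum>\<eta>\<in>X. weight \<eta> * rate \<gamma> p i j \<eta> * (f (swap \<eta> i j) * (g \<eta> - g (swap \<eta> i j))))"
      by simp
    also have "\<dots> = - (\<Sum>\<eta>\<in>X. weight \<eta> * rate \<gamma> p i j \<eta> * ((f (swap \<eta> i j) - f \<eta>) * (g (swap \<eta> i j) - g \<eta>)))"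
      unfolding sum.distrib[symmetric] sum_negf[symmetric] by (intro sum.cong refl) (simp add: algebra_simps)
    finally show ?thesis .
  qed
  have "ip f (gen \<gamma> g) = (\<Sum>\<eta>\<in>X. \<Sum>i\<in>sites. \<Sum>j\<in>sites. weight \<eta> * rate \<gamma> p i j \<eta> * (f \<eta> * (g (swap \<eta> i j) - g \<eta>))) / (2 * real N)"
  proof -
    have "weight \<eta> * f \<eta> * gen \<gamma> g \<eta>
        = (\<Sum>i\<in>sites. \<Sum>j\<in>sites. weight \<eta> * rate \<gamma> p i j \<eta> * (f \<eta> * (g (swap \<eta> i j) - g \<eta>))) / (2 * real N)" for \<eta>
      unfolding gen_def times_divide_eq_right sum_distrib_left
      by (intro arg_cong2[of _ _ _ _ "(/)"] sum.cong refl) (simp only: mult_ac)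
    thus ?thesis unfolding weighted_inner_def by (simp only: sum_divide_distrib)
  qed
  also have "(\<Sum>\<eta>\<in>X. \<Sum>i\<in>sites. \<Sum>j\<in>sites. weight \<eta> * rate \<gamma> p i j \<eta> * (f \<eta> * (g (swap \<eta> i j) - g \<eta>)))
      = (\<Sum>i\<in>sites. \<Sum>\<eta>\<in>X. \<Sum>j\<in>sites. weight \<eta> * rate \<gamma> p i j \<eta> * (f \<eta> * (g (swap \<eta> i j) - g \<eta>)))"
    by (rule sum.swap)
  also have "\<dots> = (\<Sum>i\<in>sites. \<Sum>j\<in>sites. \<Sum>\<eta>\<in>X. weight \<eta> * rate \<gamma> p i j \<eta> * (f \<eta> * (g (swap \<eta> i j) - g \<eta>)))"
    by (intro sum.cong refl sum.swap)
  also have "\<dots> = (\<Sum>i\<in>sites. \<Sum>j\<in>sites. - (\<Sum>\<eta>\<in>X. weight \<eta> * rate \<gamma> p i j \<eta> * ((f (swap \<eta> i j) - f \<eta>) * (g (swap \<eta> i j) - g \<eta>))) / 2)"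
    proof (intro sum.cong refl)
    fix i j assume "i \<in> sites" "j \<in> sites"
    from edge[OF this] show "(\<Sum>\<eta>\<in>X. weight \<eta> * rate \<gamma> p i j \<eta> * (f \<eta> * (g (swap \<eta> i j) - g \<eta>)))
      = - (\<Sum>\<eta>\<in>X. weight \<eta> * rate \<gamma> p i j \<eta> * ((f (swap \<eta> i j) - f \<eta>) * (g (swap \<eta> i j) - g \<eta>))) / 2"
      by linarith
  qed
  finally show ?thesis
    unfolding dirichlet_def sum_divide_distrib[symmetric] sum_negf by simp
qed

lemma dirichlet_nonneg: "0 \<le> \<gamma> \<Longrightarrow> 0 \<le> dirichlet \<gamma> f f"
  unfolding dirichlet_def
  by (rule divide_nonneg_nonneg, intro sum_nonneg, rule mult_nonneg_nonneg, rule mult_nonneg_nonneg)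
     (simp_all add: weight_nonneg rate_nonneg)

section \<open>Functions of the occupation variables and the discrete-time chain\<close>

definition color_blind :: "((nat \<Rightarrow> nat) \<Rightarrow> real) \<Rightarrow> bool" where
  "color_blind f \<longleftrightarrow> (\<forall>\<eta>\<in>X. \<forall>\<zeta>\<in>X. (\<forall>i. \<eta> i = 0 \<longleftrightarrow> \<zeta> i = 0) \<longrightarrow> f \<eta> = f \<zeta>)"

lemma color_blindD:
  "color_blind f \<Longrightarrow> \<eta> \<in> X \<Longrightarrow> \<zeta> \<in> X \<Longrightarrow> (\<And>i. \<eta> i = 0 \<longleftrightarrow> \<zeta> i = 0) \<Longrightarrow> f \<eta> = f \<zeta>"
  unfolding color_blind_def by blast

text \<open>For a \<open>color_blind\<close> function only exchanges of a particle with a hole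
  matter, so this is the Lipschitz constant for the graph of occupations joined by single jumps.
  Like \<open>color_blind\<close>, it looks only at values on \<open>X\<close>.\<close>

definition lip :: "real \<Rightarrow> ((nat \<Rightarrow> nat) \<Rightarrow> real) \<Rightarrow> bool" where
  "lip K f \<longleftrightarrow> (\<forall>\<eta>\<in>X. \<forall>i\<in>sites. \<forall>j\<in>sites. \<bar>f (swap \<eta> i j) - f \<eta>\<bar> \<le> K)"

lemma lipD: "lip K f \<Longrightarrow> \<eta> \<in> X \<Longrightarrow> i \<in> sites \<Longrightarrow> j \<in> sites \<Longrightarrow> \<bar>f (swap \<eta> i j) - f \<eta>\<bar> \<le> K"
  by (simp add: lip_def)

text \<open>The averaging operator of a lazy chain: with probability 1/2 nothing happens, otherwise
  an ordered pair, diagonal included, is drawn uniformly and exchanged with probability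
  \<open>base_rate\<close>. Coupling is simpler in discrete time.\<close>

definition step :: "((nat \<Rightarrow> nat) \<Rightarrow> real) \<Rightarrow> (nat \<Rightarrow> nat) \<Rightarrow> real" where
  "step f \<eta> = f \<eta> + gen 0 f \<eta> / real N"

lemma color_blind_gen:
  assumes "color_blind f"
  shows "color_blind (gen 0 f)"
  unfolding color_blind_def
proof (intro ballI impI)
  fix \<eta> \<zeta> assume X: "\<eta> \<in> X" "\<zeta> \<in> X" and supp: "\<forall>i. \<eta> i = 0 \<longleftrightarrow> \<zeta> i = 0"
  have "rate 0 p i j \<eta> * (f (swap \<eta> i j) - f \<eta>) = rate 0 p i j \<zeta> * (f (swap \<zeta> i j) - f \<zeta>)"
    if "i \<in> sites" "j \<in> sites" for i j
  proof -
    have "f (swap \<eta> i j) = f (swap \<zeta> i j)"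
      by (rule color_blindD[OF assms]) (simp_all only: swap_config X that o_apply supp)
    moreover have "f \<eta> = f \<zeta>" by (rule color_blindD[OF assms]) (simp_all only: X supp)
    moreover have "rate 0 p i j \<eta> = rate 0 p i j \<zeta>"
      unfolding rate_zero by (rule base_rate_cong) (simp_all only: supp)
    ultimately show ?thesis by simp
  qed
  thus "gen 0 f \<eta> = gen 0 f \<zeta>"
    unfolding gen_def by (intro arg_cong2[of _ _ _ _ "(/)"] sum.cong refl)
qed

lemma color_blind_step:
  assumes "color_blind f"
  shows "color_blind (step f)"
  unfolding color_blind_def
proof (intro ballI impI)
  fix \<eta> \<zeta> assume h: "\<eta> \<in> X" "\<zeta> \<in> X" "\<forall>i. \<eta> i = 0 \<longleftrightarrow> \<zeta> i = 0"
  have "f \<eta> = f \<zeta>" by (rule color_blindD[OF assms]) (simp_all only: h)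
  moreover have "gen 0 f \<eta> = gen 0 f \<zeta>"
    by (rule color_blindD[OF color_blind_gen[OF assms]]) (simp_all only: h)
  ultimately show "step f \<eta> = step f \<zeta>" by (simp only: step_def)
qed

section \<open>Path coupling for the occupation variables\<close>

lemma lip_nonneg:
  assumes "lip K f" "\<eta> \<in> X"
  shows "0 \<le> K"
  using lipD[OF assms, of 1 1] N_ge_2 by simp

text \<open>A configuration \<open>\<eta>\<close> with a particle at \<open>x\<close> and a hole at \<open>y\<close> is coupled to \<open>swap \<eta> x y\<close> by
  letting the update of the pair \<open>{i, j}\<close> in the former go with the update of the pair
  \<open>{\<tau> i, \<tau> j}\<close> in the latter, where \<open>\<tau>\<close> exchanges \<open>x\<close> and \<open>y\<close>. The two occupations coalesce for
  the pair \<open>{x, z}\<close> if \<open>z\<close> is empty and for \<open>{y, z}\<close> if \<open>z\<close> is occupied, at rate at least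
  \<open>\<epsilon>\<^sup>2\<close> for each \<open>z \<noteq> x\<close>; no other pair increases the distance.\<close>

definition site_partner :: "(nat \<Rightarrow> nat) \<Rightarrow> nat \<Rightarrow> nat \<Rightarrow> nat \<Rightarrow> nat" where
  "site_partner \<eta> x y z = (if \<eta> z = 0 then x else y)"

text \<open>A lower bound, symmetric in i and j, for the probability of coalescence at this pair.
  The site x is excluded as z because its partner is y, and the pair of x and y is already counted
  for z = y.\<close>

definition coalescence :: "(nat \<Rightarrow> nat) \<Rightarrow> nat \<Rightarrow> nat \<Rightarrow> nat \<Rightarrow> nat \<Rightarrow> real" where
  "coalescence \<eta> x y i j = \<epsilon>\<^sup>2 *
     (of_bool (i = site_partner \<eta> x y j \<and> j \<noteq> x) + of_bool (j = site_partner \<eta> x y i \<and> i \<noteq> x))"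

text \<open>By \<open>swap_conjugate\<close>, \<open>swap (swap \<eta> i j) x y\<close> is the
  result of the matched update of \<open>swap \<eta> x y\<close>.\<close>

definition coupled_increment ::
  "((nat \<Rightarrow> nat) \<Rightarrow> real) \<Rightarrow> (nat \<Rightarrow> nat) \<Rightarrow> nat \<Rightarrow> nat \<Rightarrow> nat \<Rightarrow> nat \<Rightarrow> real" where
  "coupled_increment f \<eta> x y i j =
     base_rate p i j (occ \<eta>) * (f (swap \<eta> i j) - f \<eta>)
     - base_rate p (Transposition.transpose x y i) (Transposition.transpose x y j) (occ (swap \<eta> x y)) *
       (f (swap (swap \<eta> i j) x y) - f (swap \<eta> x y))"

lemma coalescence_commute: "coalescence \<eta> x y i j = coalescence \<eta> x y j i"
  by (simp add: coalescence_def add.commute)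

lemma coupled_increment_commute: "coupled_increment f \<eta> x y i j = coupled_increment f \<eta> x y j i"
  unfolding coupled_increment_def
  by (subst (1 2) base_rate_commute, subst (1 2) transpose_commute[of i j]) (rule refl)

lemma sum_coalescence:
  assumes "x \<in> sites" "y \<in> sites"
  shows "(\<Sum>i\<in>sites. \<Sum>j\<in>sites. coalescence \<eta> x y i j) \<ge> \<epsilon>\<^sup>2 * real N"
proof -
  let ?s = "site_partner \<eta> x y"
  have s: "?s j \<in> sites" for j using assms by (simp add: site_partner_def)
  have 1: "(\<Sum>j\<in>sites. \<Sum>i\<in>sites. of_bool (i = ?s j \<and> j \<noteq> x) :: real) = real N - 1"
  proof -
    have "(\<Sum>i\<in>sites. of_bool (i = ?s j \<and> j \<noteq> x) :: real) = of_bool (j \<noteq> x)" for j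
    proof (cases "j = x")
      case False
      hence "(\<Sum>i\<in>sites. of_bool (i = ?s j \<and> j \<noteq> x) :: real) = (\<Sum>i\<in>sites. if i = ?s j then 1 else 0)"
        by (intro sum.cong refl) auto
      thus ?thesis using s[of j] False by (simp add: sum.delta)
    qed simp
    hence "(\<Sum>j\<in>sites. \<Sum>i\<in>sites. of_bool (i = ?s j \<and> j \<noteq> x) :: real) = (\<Sum>j\<in>sites. of_bool (j \<noteq> x))"
      by (simp only:)
    also have "\<dots> = (\<Sum>j\<in>sites. 1 - (if j = x then 1 else 0))" by (intro sum.cong refl) auto
    also have "\<dots> = real N - 1" using assms(1) by (simp add: sum_subtractf sum.delta)
    finally show ?thesis .
  qed
  have "(\<Sum>i\<in>sites. \<Sum>j\<in>sites. coalescence \<eta> x y i j)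
      = \<epsilon>\<^sup>2 * ((\<Sum>i\<in>sites. \<Sum>j\<in>sites. of_bool (i = ?s j \<and> j \<noteq> x))
        + (\<Sum>i\<in>sites. \<Sum>j\<in>sites. of_bool (j = ?s i \<and> i \<noteq> x)))"
    unfolding coalescence_def sum_distrib_left[symmetric] sum.distrib ..
  also have "(\<Sum>i\<in>sites. \<Sum>j\<in>sites. of_bool (i = ?s j \<and> j \<noteq> x) :: real) = real N - 1"
    by (subst sum.swap) (rule 1)
  also have "(\<Sum>i\<in>sites. \<Sum>j\<in>sites. of_bool (j = ?s i \<and> i \<noteq> x) :: real) = real N - 1"
    by (rule 1)
  \<comment> \<open>There are N - 1 choices of z, each counted in both orders, and
    \<open>2 * (N - 1)\<close> is at least \<open>N\<close>.\<close>
  also have "\<epsilon>\<^sup>2 * (real N - 1 + (real N - 1)) \<ge> \<epsilon>\<^sup>2 * real N"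
    by (rule mult_left_mono) (use N_ge_2 in auto)
  finally show ?thesis .
qed

text \<open>Adding the present difference turns the increment into the expected difference after one
  coupled update. It is a combination, with nonnegative coefficients, of differences across single
  exchanges, and coalescence is the mass missing from these coefficients.\<close>

lemma coupled_increment_bound:
  assumes f: "color_blind f" "lip K f" and \<eta>: "\<eta> \<in> X"
    and xy: "x \<in> sites" "y \<in> sites" "\<eta> x \<noteq> 0" "\<eta> y = 0" and ij: "i \<in> sites" "j \<in> sites"
  shows "\<bar>coupled_increment f \<eta> x y i j + (f \<eta> - f (swap \<eta> x y))\<bar> \<le> (1 - coalescence \<eta> x y i j) * K"
proof -
  let ?\<tau> = "Transposition.transpose x y" and ?\<zeta> = "swap \<eta> x y"
  have neq: "x \<noteq> y" using xy by auto
  have \<zeta>: "?\<zeta> \<in> X" using swap_config \<eta> xy by simp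
  have \<zeta>\<tau>: "?\<zeta> (?\<tau> k) = \<eta> k" for k by simp
  have \<tau>_sites: "?\<tau> k \<in> sites" if "k \<in> sites" for k
    using xy that by (auto simp: Transposition.transpose_def)
  have D: "\<bar>f \<eta> - f ?\<zeta>\<bar> \<le> K" using lipD[OF f(2) \<eta> xy(1,2)] by (simp add: abs_minus_commute)
  have K: "0 \<le> K" by (rule lip_nonneg[OF f(2) \<eta>])
  have eps: "\<epsilon>\<^sup>2 \<le> 1" using eps_pos eps_less by (simp add: power_le_one)
  \<comment> \<open>The pair contains exactly one of x and y. Unless that site is the partner of j,
    both configurations are blocked.\<close>
  have one_moved: "\<bar>coupled_increment f \<eta> x y i j + (f \<eta> - f ?\<zeta>)\<bar> \<le> (1 - coalescence \<eta> x y i j) * K"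
    if ij: "i \<in> sites" "j \<in> sites" and i: "i = x \<or> i = y" and j: "j \<noteq> x" "j \<noteq> y" for i j
  proof -
    let ?a = "base_rate p i j (occ \<eta>)" and ?b = "base_rate p (?\<tau> i) (?\<tau> j) (occ ?\<zeta>)"
    let ?U = "swap \<eta> i j"
    let ?U' = "swap ?U x y"
    have second: "j \<noteq> site_partner \<eta> x y i" using j by (simp add: site_partner_def)
    show ?thesis
    proof (cases "i = site_partner \<eta> x y j")
      case False
      have eq: "\<eta> i = 0 \<longleftrightarrow> \<eta> j = 0" using False i xy by (auto simp: site_partner_def split: if_splits)
      have "?a = 0" by (rule base_rate_blocked) (rule eq)
      moreover have "?b = 0" by (rule base_rate_blocked) (simp only: \<zeta>\<tau> eq)
      ultimately have "coupled_increment f \<eta> x y i j = 0" by (simp only: coupled_increment_def mult_zero_left diff_self)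
      moreover have "coalescence \<eta> x y i j = 0" using False second by (simp add: coalescence_def)
      ultimately show ?thesis using D by simp
    next
      case True
      have coal: "coalescence \<eta> x y i j = \<epsilon>\<^sup>2" using True second j by (simp add: coalescence_def)
      have ne: "(\<eta> i = 0) \<noteq> (\<eta> j = 0)" using True xy by (auto simp: site_partner_def split: if_splits)
      have U: "?U \<in> X" using swap_config \<eta> ij by simp
      have U': "?U' \<in> X" using swap_config U xy by simp
      \<comment> \<open>After the exchange x and y are both occupied or both empty, so the two
        configurations have the same occupation.\<close>
      have UU': "f ?U' = f ?U"
      proof (rule color_blindD[OF f(1) U' U])
        fix k
        have "?U x = 0 \<longleftrightarrow> ?U y = 0"
          using True xy neq j by (auto simp: site_partner_def Transposition.transpose_def split: if_splits)
        thus "?U' k = 0 \<longleftrightarrow> ?U k = 0" by (rule swap_empty_iff)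
      qed
      have a: "\<epsilon>\<^sup>2 \<le> ?a" "?a \<le> 1" using base_rate_ge[of i j \<eta>] base_rate_bounds[of i j] ij ne by auto
      have b: "\<epsilon>\<^sup>2 \<le> ?b" "?b \<le> 1"
        using base_rate_ge[of "?\<tau> i" "?\<tau> j" ?\<zeta>] base_rate_bounds[of "?\<tau> i" "?\<tau> j" ?\<zeta>] \<tau>_sites[OF ij(1)] \<tau>_sites[OF ij(2)] ne
        unfolding \<zeta>\<tau> by auto
      have V1: "\<bar>f ?U - f \<eta>\<bar> \<le> K" by (rule lipD[OF f(2) \<eta> ij])
      have V2: "\<bar>f ?U - f ?\<zeta>\<bar> \<le> K"
        using lipD[OF f(2) \<zeta> \<tau>_sites[OF ij(1)] \<tau>_sites[OF ij(2)]] unfolding swap_conjugate UU' .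
      have t: "coupled_increment f \<eta> x y i j = ?a * (f ?U - f \<eta>) - ?b * (f ?U - f ?\<zeta>)"
        by (simp only: coupled_increment_def UU')
      show ?thesis
      \<comment> \<open>The rates of the two configurations differ, so they are coupled maximally:
        both jump with probability the smaller rate, at least \<open>\<epsilon>\<^sup>2\<close>, and
        then coalesce. Only one jumps with probability the difference of the rates, which still
        leaves a single exchange between them.\<close>
      proof (cases "?b \<le> ?a")
        case True
        have "coupled_increment f \<eta> x y i j + (f \<eta> - f ?\<zeta>) = (1 - ?a) * (f \<eta> - f ?\<zeta>) + (?a - ?b) * (f ?U - f ?\<zeta>)"
          unfolding t by (simp only: algebra_simps)
        also have "\<bar>\<dots>\<bar> \<le> (1 - \<epsilon>\<^sup>2) * K"
          by (rule convex_combination_bound) (use True a b D V2 in linarith)+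
        finally show ?thesis by (simp only: coal)
      next
        case False
        have "coupled_increment f \<eta> x y i j + (f \<eta> - f ?\<zeta>) = (1 - ?b) * (f \<eta> - f ?\<zeta>) + (?b - ?a) * (f \<eta> - f ?U)"
          unfolding t by (simp only: algebra_simps)
        also have "\<bar>\<dots>\<bar> \<le> (1 - \<epsilon>\<^sup>2) * K"
          by (rule convex_combination_bound) (use False a b D V1 in linarith)+
        finally show ?thesis by (simp only: coal)
      qed
    qed
  qed
  \<comment> \<open>The heat bath forgets the arrangement on x and y, so the expected difference is
    0; \<open>\<epsilon>\<^sup>2\<close> is all that has to be credited here.\<close>
  have main: "\<bar>coupled_increment f \<eta> x y x y + (f \<eta> - f ?\<zeta>)\<bar> \<le> (1 - coalescence \<eta> x y x y) * K"
  proof -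
    have coal: "coalescence \<eta> x y x y = \<epsilon>\<^sup>2" using xy neq by (auto simp: coalescence_def site_partner_def)
    have bath: "base_rate p y x (occ ?\<zeta>) = 1 - base_rate p x y (occ \<eta>)"
      using base_rate_heat_bath[OF xy] base_rate_commute[of x y] by (simp add: algebra_simps)
    have swap_back: "swap ?\<zeta> x y = \<eta>" by (simp add: o_assoc[symmetric])
    have "coupled_increment f \<eta> x y x y + (f \<eta> - f ?\<zeta>) = 0"
      unfolding coupled_increment_def swap_back by (simp add: bath) (simp add: algebra_simps)
    thus ?thesis unfolding coal using eps K by simp
  qed
  consider "i \<notin> {x, y}" "j \<notin> {x, y}" | "i \<in> {x, y}" "j \<notin> {x, y}" | "i \<notin> {x, y}" "j \<in> {x, y}"
    | "i = j" "i \<in> {x, y}" | "i = x" "j = y" | "i = y" "j = x" by blast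
  thus ?thesis
  proof cases
    case 1
    have fix_ij: "?\<tau> i = i" "?\<tau> j = j" using 1 by (auto simp: transpose_apply_other)
    have rates: "base_rate p i j (occ ?\<zeta>) = base_rate p i j (occ \<eta>)"
      by (rule base_rate_cong) (simp_all add: fix_ij)
    have "coalescence \<eta> x y i j = 0" using 1 by (auto simp: coalescence_def site_partner_def)
    moreover have "coupled_increment f \<eta> x y i j + (f \<eta> - f ?\<zeta>)
        = base_rate p i j (occ \<eta>) * (f (swap \<eta> i j) - f (swap (swap \<eta> i j) x y))
          + (1 - base_rate p i j (occ \<eta>)) * (f \<eta> - f ?\<zeta>)"
      unfolding coupled_increment_def fix_ij rates by (simp only: algebra_simps)
    moreover have "\<bar>\<dots>\<bar> \<le> 1 * K"
    proof (rule convex_combination_bound)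
      show "\<bar>f (swap \<eta> i j) - f (swap (swap \<eta> i j) x y)\<bar> \<le> K"
        using lipD[OF f(2) swap_config[OF \<eta> ij] xy(1,2)] by (simp only: abs_minus_commute)
    qed (use base_rate_bounds[OF ij] D in auto)
    ultimately show ?thesis by (simp only: diff_zero)
  next
    case 2
    thus ?thesis using one_moved[OF ij] by auto
  next
    case 3
    thus ?thesis using one_moved[OF ij(2,1)] coalescence_commute[of \<eta> x y i j] coupled_increment_commute[of f \<eta> x y i j] by auto
  next
    case 4
    have "coupled_increment f \<eta> x y i j = 0" using 4(1) by (simp add: coupled_increment_def)
    moreover have "coalescence \<eta> x y i j = 0" using 4 xy neq by (auto simp: coalescence_def site_partner_def)
    ultimately show ?thesis using D by simp
  next
    case 5
    thus ?thesis using main by simp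
  next
    case 6
    thus ?thesis using main coalescence_commute[of \<eta> x y x y] coupled_increment_commute[of f \<eta> x y x y] by simp
  qed
qed

text \<open>Coalescing pairs carry a total mass of at least \<open>\<epsilon>\<^sup>2 * N\<close>,
  and each ordered pair has weight \<open>1 / (2 * N\<^sup>2)\<close> in one step.\<close>

definition contraction :: real where
  "contraction = 1 - \<epsilon>\<^sup>2 / (2 * real N)"

lemma lip_step_aux:
  assumes f: "color_blind f" "lip K f" and \<eta>: "\<eta> \<in> X"
    and xy: "x \<in> sites" "y \<in> sites" "\<eta> x \<noteq> 0" "\<eta> y = 0"
  shows "\<bar>step f (swap \<eta> x y) - step f \<eta>\<bar> \<le> contraction * K"
proof -
  let ?\<tau> = "Transposition.transpose x y" and ?\<zeta> = "swap \<eta> x y"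
  define D where "D = f \<eta> - f ?\<zeta>"
  define s where "s = 1 / (2 * (real N)\<^sup>2)"
  define t where "t = coupled_increment f \<eta> x y"
  have K: "0 \<le> K" by (rule lip_nonneg[OF f(2) \<eta>])
  have N: "real N > 0" using N_ge_2 by simp
  have s: "s > 0" using N by (simp add: s_def)
  have D_le: "\<bar>D\<bar> \<le> K" using lipD[OF f(2) \<eta> xy(1,2)] by (simp add: D_def abs_minus_commute)
  have \<tau>: "?\<tau> permutes sites" using xy by (simp add: permutes_swap_id)
  \<comment> \<open>Both indices are relabelled by the exchange of x and y, which is how the
    coupling enters: no joint chain is built, only the sums are matched term by term.\<close>
  have gen_swap: "gen 0 f ?\<zeta> = (\<Sum>i\<in>sites. \<Sum>j\<in>sites. base_rate p (?\<tau> i) (?\<tau> j) (occ ?\<zeta>) *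
       (f (swap (swap \<eta> i j) x y) - f ?\<zeta>)) / (2 * real N)"
  proof -
    define F where "F i j = base_rate p i j (occ ?\<zeta>) * (f (swap ?\<zeta> i j) - f ?\<zeta>)" for i j
    have "(\<Sum>i\<in>sites. \<Sum>j\<in>sites. F i j) = (\<Sum>i\<in>sites. \<Sum>j\<in>sites. F (?\<tau> i) j)"
      using sum.permute[OF \<tau>, of "\<lambda>i. \<Sum>j\<in>sites. F i j"] by (simp only: o_def)
    also have "\<dots> = (\<Sum>i\<in>sites. \<Sum>j\<in>sites. F (?\<tau> i) (?\<tau> j))"
      using sum.permute[OF \<tau>, of "F (?\<tau> i)" for i] by (simp only: o_def)
    finally show ?thesis unfolding F_def gen_def rate_zero swap_conjugate by (simp only:)
  qed
  have "gen 0 f \<eta> - gen 0 f ?\<zeta> = (\<Sum>i\<in>sites. \<Sum>j\<in>sites. t i j) / (2 * real N)"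
    unfolding gen_swap unfolding gen_def rate_zero t_def coupled_increment_def diff_divide_distrib[symmetric] sum_subtractf[symmetric] ..
  hence "step f \<eta> - step f ?\<zeta> = D + s * (\<Sum>i\<in>sites. \<Sum>j\<in>sites. t i j)"
    using N unfolding step_def D_def s_def by (simp add: field_simps power2_eq_square)
  \<comment> \<open>The lazy half keeps D / 2; the other half is distributed over the ordered pairs
    as the present difference required by \<open>coupled_increment_bound\<close>.\<close>
  also have "\<dots> = D / 2 + s * (\<Sum>i\<in>sites. \<Sum>j\<in>sites. t i j + D)"
    using N by (simp add: sum.distrib s_def field_simps power2_eq_square)
  finally have eq: "step f \<eta> - step f ?\<zeta> = D / 2 + s * (\<Sum>i\<in>sites. \<Sum>j\<in>sites. t i j + D)" .
  have "\<bar>\<Sum>i\<in>sites. \<Sum>j\<in>sites. t i j + D\<bar> \<le> (\<Sum>i\<in>sites. \<bar>\<Sum>j\<in>sites. t i j + D\<bar>)"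
    by (rule sum_abs)
  also have "\<dots> \<le> (\<Sum>i\<in>sites. \<Sum>j\<in>sites. \<bar>t i j + D\<bar>)"
    by (intro sum_mono sum_abs)
  also have "\<dots> \<le> (\<Sum>i\<in>sites. \<Sum>j\<in>sites. (1 - coalescence \<eta> x y i j) * K)"
    unfolding t_def D_def by (intro sum_mono coupled_increment_bound f \<eta> xy)
  also have "\<dots> = ((real N)\<^sup>2 - (\<Sum>i\<in>sites. \<Sum>j\<in>sites. coalescence \<eta> x y i j)) * K"
    by (simp add: sum_distrib_right[symmetric] sum_subtractf power2_eq_square)
  also have "\<dots> \<le> ((real N)\<^sup>2 - \<epsilon>\<^sup>2 * real N) * K"
    by (rule mult_right_mono[OF _ K]) (use sum_coalescence[OF xy(1,2), of \<eta>] in simp)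
  finally have "s * \<bar>\<Sum>i\<in>sites. \<Sum>j\<in>sites. t i j + D\<bar> \<le> s * (((real N)\<^sup>2 - \<epsilon>\<^sup>2 * real N) * K)"
    by (rule mult_left_mono) (use s in simp)
  also have "\<dots> = (1 / 2 - \<epsilon>\<^sup>2 / (2 * real N)) * K"
    using N by (simp add: s_def field_simps power2_eq_square)
  finally have "\<bar>D / 2\<bar> + s * \<bar>\<Sum>i\<in>sites. \<Sum>j\<in>sites. t i j + D\<bar> \<le> contraction * K"
    using D_le by (simp add: contraction_def algebra_simps)
  moreover have "\<bar>step f \<eta> - step f ?\<zeta>\<bar> \<le> \<bar>D / 2\<bar> + s * \<bar>\<Sum>i\<in>sites. \<Sum>j\<in>sites. t i j + D\<bar>"
    unfolding eq using abs_triangle_ineq[of "D / 2" "s * (\<Sum>i\<in>sites. \<Sum>j\<in>sites. t i j + D)"] s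
    by (simp add: abs_mult)
  ultimately show ?thesis by (simp only: abs_minus_commute)
qed

lemma contraction_pos: "0 < contraction"
proof -
  have "\<epsilon>\<^sup>2 \<le> 1" using eps_pos eps_less by (simp add: power_le_one)
  thus ?thesis using N_ge_2 by (simp add: contraction_def divide_less_eq)
qed

lemma lip_step:
  assumes f: "color_blind f" "lip K f"
  shows "lip (contraction * K) (step f)"
  unfolding lip_def
proof (intro ballI)
  fix \<eta> x y assume \<eta>: "\<eta> \<in> X" and xy: "x \<in> sites" "y \<in> sites"
  consider "\<eta> x = 0 \<longleftrightarrow> \<eta> y = 0" | "\<eta> x \<noteq> 0" "\<eta> y = 0" | "\<eta> x = 0" "\<eta> y \<noteq> 0" by blast
  thus "\<bar>step f (swap \<eta> x y) - step f \<eta>\<bar> \<le> contraction * K"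
  proof cases
    case 1
    have "step f (swap \<eta> x y) = step f \<eta>"
    proof (rule color_blindD[OF color_blind_step[OF f(1)] swap_config[OF \<eta> xy] \<eta>])
      fix k show "swap \<eta> x y k = 0 \<longleftrightarrow> \<eta> k = 0" using 1 by (rule swap_empty_iff)
    qed
    thus ?thesis using contraction_pos lip_nonneg[OF f(2) \<eta>] by simp
  next
    case 2
    thus ?thesis using lip_step_aux[OF f \<eta> xy] by simp
  next
    case 3
    thus ?thesis using lip_step_aux[OF f \<eta> xy(2,1)] by (simp add: transpose_commute)
  qed
qed

text \<open>Any two configurations differ by a permutation, a product of transpositions. The
  constant may depend on everything but f, since \<open>log_convex_decay\<close> is insensitive to
  it; summing over all permutations is crude but sufficient.\<close>

lemma lip_oscillation:
  "\<exists>C\<ge>0. \<forall>f K \<eta> \<zeta>. lip K f \<longrightarrow> \<eta> \<in> X \<longrightarrow> \<zeta> \<in> X \<longrightarrow> \<bar>f \<eta> - f \<zeta>\<bar> \<le> C * K"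
proof -
  have "\<exists>c\<ge>0. \<forall>f K \<eta>. lip K f \<longrightarrow> \<eta> \<in> X \<longrightarrow> \<bar>f (\<eta> \<circ> \<pi>) - f \<eta>\<bar> \<le> c * K" if "\<pi> permutes sites" for \<pi>
    using finite_atLeastAtMost that
  proof (induction rule: permutes_rev_induct)
    case id
    show ?case by (rule exI[of _ 0]) simp
  next
    case (swap a b \<pi>)
    then obtain c where c: "c \<ge> 0" "\<And>f K \<eta>. lip K f \<Longrightarrow> \<eta> \<in> X \<Longrightarrow> \<bar>f (\<eta> \<circ> \<pi>) - f \<eta>\<bar> \<le> c * K" by blast
    show ?case
    proof (intro exI[of _ "c + 1"] conjI allI impI)
      fix f K \<eta> assume f: "lip K f" and \<eta>: "\<eta> \<in> X"
      have "\<eta> \<circ> \<pi> \<in> X" by (rule perm_closedD[OF perm_closed_configs \<eta>]) (rule swap.hyps)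
      from lipD[OF f this, of a b] swap.hyps c(2)[OF f \<eta>]
      show "\<bar>f (\<eta> \<circ> (\<pi> \<circ> Transposition.transpose a b)) - f \<eta>\<bar> \<le> (c + 1) * K"
        by (simp add: o_assoc algebra_simps)
    qed (use c in simp)
  qed
  hence "\<forall>\<pi>\<in>{\<pi>. \<pi> permutes sites}. \<exists>c. c \<ge> 0 \<and>
      (\<forall>f K \<eta>. lip K f \<longrightarrow> \<eta> \<in> X \<longrightarrow> \<bar>f (\<eta> \<circ> \<pi>) - f \<eta>\<bar> \<le> c * K)" by blast
  from bchoice[OF this] obtain c where c: "\<And>\<pi>. \<pi> permutes sites \<Longrightarrow> c \<pi> \<ge> 0"
      "\<And>\<pi> f K \<eta>. \<pi> permutes sites \<Longrightarrow> lip K f \<Longrightarrow> \<eta> \<in> X \<Longrightarrow> \<bar>f (\<eta> \<circ> \<pi>) - f \<eta>\<bar> \<le> c \<pi> * K"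
    by blast
  define C where "C = (\<Sum>\<pi> | \<pi> permutes sites. c \<pi>)"
  have fin: "finite {\<pi>. \<pi> permutes sites}" by (rule finite_permutations) simp
  show ?thesis
  proof (intro exI[of _ C] conjI allI impI)
    show "0 \<le> C" unfolding C_def using c by (intro sum_nonneg) auto
    fix f K \<eta> \<zeta> assume h: "lip K f" "\<eta> \<in> X" "\<zeta> \<in> X"
    have "\<eta> i = \<zeta> i" if "i \<notin> sites" for i
      using config_outside[OF h(2) that] config_outside[OF h(3) that] by simp
    from configs_transitive[OF h(2,3) subset_refl this]
    obtain \<pi> where \<pi>: "\<pi> permutes sites" "\<eta> = \<zeta> \<circ> \<pi>" .
    have "c \<pi> \<le> C" unfolding C_def by (rule member_le_sum) (use \<pi> c fin in auto)
    hence "c \<pi> * K \<le> C * K" by (rule mult_right_mono) (rule lip_nonneg[OF h(1,2)])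
    thus "\<bar>f \<eta> - f \<zeta>\<bar> \<le> C * K" using c(2)[OF \<pi>(1) h(1,3)] \<pi>(2) by simp
  qed
qed

lemma inner_step: "ip f (step g) = ip f g - dirichlet 0 f g / real N"
proof -
  have "ip f (step g) = ip f g + ip f (gen 0 g) / real N"
    unfolding weighted_inner_def step_def
    by (simp add: algebra_simps sum.distrib sum_divide_distrib)
  thus ?thesis by (simp add: inner_gen)
qed

text \<open>The Lipschitz constants of the iterates decay like powers of \<open>contraction\<close>.
  As their mean stays 0, so do their suprema and norms, and
  \<open>weighted_inner_contraction\<close> turns this into a bound on one step, which is the
  Poincare inequality.\<close>

theorem color_blind_gap:
  assumes f: "color_blind f" and mean: "(\<Sum>\<eta>\<in>X. weight \<eta> * f \<eta>) = 0"
  shows "\<epsilon>\<^sup>2 / 2 * ip f f \<le> dirichlet 0 f f"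
proof -
  let ?g = "\<lambda>k. (step ^^ k) f"
  define K where "K = 2 * (\<Sum>\<eta>\<in>X. \<bar>f \<eta>\<bar>)"
  define W where "W = (\<Sum>\<eta>\<in>X. weight \<eta>)"
  obtain C where C: "C \<ge> 0" "\<And>f K \<eta> \<zeta>. lip K f \<Longrightarrow> \<eta> \<in> X \<Longrightarrow> \<zeta> \<in> X \<Longrightarrow> \<bar>f \<eta> - f \<zeta>\<bar> \<le> C * K"
    using lip_oscillation by blast
  have W_nonneg: "0 \<le> W" unfolding W_def by (intro sum_nonneg weight_nonneg)
  have "lip K f"
    unfolding lip_def
  proof (intro ballI)
    fix \<eta> i j assume "\<eta> \<in> X" "i \<in> sites" "j \<in> sites"
    hence "swap \<eta> i j \<in> X" "\<eta> \<in> X" using swap_config by auto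
    hence "\<bar>f (swap \<eta> i j)\<bar> \<le> (\<Sum>\<eta>\<in>X. \<bar>f \<eta>\<bar>)" "\<bar>f \<eta>\<bar> \<le> (\<Sum>\<eta>\<in>X. \<bar>f \<eta>\<bar>)"
      by (auto intro!: member_le_sum[where f = "\<lambda>\<eta>. \<bar>f \<eta>\<bar>"] finite_configs)
    thus "\<bar>f (swap \<eta> i j) - f \<eta>\<bar> \<le> K" by (simp add: K_def)
  qed
  have iter: "color_blind (?g k) \<and> lip (contraction ^ k * K) (?g k) \<and> (\<Sum>\<eta>\<in>X. weight \<eta> * ?g k \<eta>) = 0" for k
  proof (induction k)
    case 0
    show ?case using f mean \<open>lip K f\<close> by simp
  next
    case (Suc k)
    have "ip (\<lambda>_. 1) (step (?g k)) = ip (\<lambda>_. 1) (?g k)"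
      unfolding inner_step by (simp add: dirichlet_def)
    hence "(\<Sum>\<eta>\<in>X. weight \<eta> * ?g (Suc k) \<eta>) = 0"
      using Suc by (simp add: weighted_inner_def)
    moreover have "lip (contraction * (contraction ^ k * K)) (step (?g k))"
      by (rule lip_step) (use Suc in auto)
    ultimately show ?case using Suc color_blind_step by (simp add: mult.assoc)
  qed
  have bound: "ip (?g k) (?g k) \<le> W * C\<^sup>2 * K\<^sup>2 * (contraction\<^sup>2) ^ k" for k
  proof -
    define B where "B = C * (contraction ^ k * K)"
    have "weight \<eta> * ?g k \<eta> * ?g k \<eta> \<le> weight \<eta> * B\<^sup>2" if \<eta>: "\<eta> \<in> X" for \<eta>
    proof -
      have Wpos: "W > 0" unfolding W_def by (rule sum_pos) (use finite_configs \<eta> weight_pos in auto)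
      \<comment> \<open>With mean zero the value at \<eta> is an average of differences, each
        controlled by the Lipschitz constant.\<close>
      have mean_diff: "W * ?g k \<eta> = (\<Sum>\<zeta>\<in>X. weight \<zeta> * (?g k \<eta> - ?g k \<zeta>))"
        using iter[of k] by (simp add: W_def right_diff_distrib sum_subtractf sum_distrib_right)
      have "\<bar>W * ?g k \<eta>\<bar> \<le> (\<Sum>\<zeta>\<in>X. \<bar>weight \<zeta> * (?g k \<eta> - ?g k \<zeta>)\<bar>)"
        unfolding mean_diff by (rule sum_abs)
      also have "\<dots> \<le> (\<Sum>\<zeta>\<in>X. weight \<zeta> * B)"
      proof (rule sum_mono)
        fix \<zeta> assume \<zeta>: "\<zeta> \<in> X"
        have "lip (contraction ^ k * K) (?g k)" using iter[of k] by (elim conjE)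
        hence "\<bar>?g k \<eta> - ?g k \<zeta>\<bar> \<le> B" unfolding B_def by (rule C(2)[OF _ \<eta> \<zeta>])
        thus "\<bar>weight \<zeta> * (?g k \<eta> - ?g k \<zeta>)\<bar> \<le> weight \<zeta> * B"
          unfolding abs_mult abs_of_nonneg[OF weight_nonneg] by (rule mult_left_mono[OF _ weight_nonneg])
      qed
      also have "\<dots> = W * B" by (simp add: W_def sum_distrib_right)
      finally have "\<bar>?g k \<eta>\<bar> \<le> B" using Wpos by (simp add: abs_mult)
      hence "(?g k \<eta>)\<^sup>2 \<le> B\<^sup>2" by (metis abs_ge_zero power2_abs power_mono)
      thus ?thesis using weight_nonneg[of \<eta>] by (simp add: mult.assoc mult_left_mono power2_eq_square)
    qed
    hence "ip (?g k) (?g k) \<le> (\<Sum>\<eta>\<in>X. weight \<eta> * B\<^sup>2)"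
      unfolding weighted_inner_def by (rule sum_mono)
    also have "\<dots> = W * B\<^sup>2" by (simp add: W_def sum_distrib_right)
    also have "\<dots> = W * C\<^sup>2 * K\<^sup>2 * (contraction\<^sup>2) ^ k"
      unfolding B_def power_mult_distrib power_mult[symmetric, of contraction k 2]
        power_mult[symmetric, of contraction 2 k] mult.commute[of k 2] by (simp only: mult_ac)
    finally show ?thesis .
  qed
  have "ip f (step f) \<le> contraction * ip f f"
  proof (rule weighted_inner_contraction[OF weight_nonneg _ bound contraction_pos])
    fix u v
    show "ip u (step v) = ip (step u) v"
      unfolding weighted_inner_commute[of X weight "step u" v] inner_step
        dirichlet_commute[of 0 u v] weighted_inner_commute[of X weight u v] ..
  qed
  hence "(\<epsilon>\<^sup>2 / 2 * ip f f) / real N \<le> dirichlet 0 f f / real N"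
    unfolding inner_step contraction_def by (simp add: algebra_simps)
  moreover have "0 < real N" using N_ge_2 by simp
  ultimately show ?thesis unfolding divide_le_cancel by blast
qed

section \<open>Fluctuation of the colors\<close>

definition fiber :: "(nat \<Rightarrow> nat) \<Rightarrow> (nat \<Rightarrow> nat) set" where
  "fiber \<eta> = {\<zeta> \<in> X. \<forall>i. \<zeta> i = 0 \<longleftrightarrow> \<eta> i = 0}"

text \<open>This unweighted mean is \<nu>(f | \<psi>), because \<open>weight\<close> is constant on
  a fiber.\<close>

definition color_mean :: "((nat \<Rightarrow> nat) \<Rightarrow> real) \<Rightarrow> (nat \<Rightarrow> nat) \<Rightarrow> real" where
  "color_mean f \<eta> = (\<Sum>\<zeta>\<in>fiber \<eta>. f \<zeta>) / real (card (fiber \<eta>))"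

lemma fiber_self: "\<eta> \<in> X \<Longrightarrow> \<eta> \<in> fiber \<eta>"
  and fiber_subset: "fiber \<eta> \<subseteq> X"
  by (auto simp: fiber_def)

lemma finite_fiber: "finite (fiber \<eta>)"
  using fiber_subset finite_configs by (rule finite_subset)

lemma fiber_eq: "\<zeta> \<in> fiber \<eta> \<Longrightarrow> fiber \<zeta> = fiber \<eta>"
  by (simp add: fiber_def)

lemma color_mean_fiber: "\<zeta> \<in> fiber \<eta> \<Longrightarrow> color_mean f \<zeta> = color_mean f \<eta>"
  by (simp only: color_mean_def fiber_eq)

lemma weight_fiber: "\<zeta> \<in> fiber \<eta> \<Longrightarrow> weight \<zeta> = weight \<eta>"
  by (rule weight_cong) (simp add: fiber_def)

lemma color_blind_fiber:
  assumes "color_blind u" "\<eta> \<in> X" "\<zeta> \<in> fiber \<eta>"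
  shows "u \<zeta> = u \<eta>"
  using assms unfolding color_blind_def fiber_def by blast

lemma color_blind_color_mean: "color_blind (color_mean f)"
  unfolding color_blind_def
proof (intro ballI impI)
  fix \<eta> \<zeta> assume "\<eta> \<in> X" "\<zeta> \<in> X" "\<forall>i. \<eta> i = 0 \<longleftrightarrow> \<zeta> i = 0"
  hence "\<eta> \<in> fiber \<zeta>" by (simp add: fiber_def)
  thus "color_mean f \<eta> = color_mean f \<zeta>" by (rule color_mean_fiber)
qed

lemma sum_fiber_deviation:
  assumes "\<eta> \<in> X"
  shows "(\<Sum>\<zeta>\<in>fiber \<eta>. f \<zeta> - color_mean f \<zeta>) = 0"
proof -
  have "card (fiber \<eta>) \<noteq> 0" using fiber_self[OF assms] finite_fiber[of \<eta>] by (auto simp: card_eq_0_iff)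
  moreover have "(\<Sum>\<zeta>\<in>fiber \<eta>. color_mean f \<zeta>) = (\<Sum>\<zeta>\<in>fiber \<eta>. color_mean f \<eta>)"
    by (intro sum.cong refl color_mean_fiber)
  ultimately show ?thesis by (simp add: sum_subtractf) (simp add: color_mean_def)
qed

lemma sum_configs_fiberwise:
  fixes h :: "(nat \<Rightarrow> nat) \<Rightarrow> real"
  shows "(\<Sum>\<eta>\<in>X. h \<eta>) = (\<Sum>F\<in>fiber ` X. \<Sum>\<zeta>\<in>F. h \<zeta>)"
proof -
  have "(\<Sum>\<eta>\<in>X. h \<eta>) = (\<Sum>F\<in>fiber ` X. \<Sum>\<zeta>\<in>{\<zeta> \<in> X. fiber \<zeta> = F}. h \<zeta>)"
    by (rule sum.image_gen[OF finite_configs])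
  also have "\<dots> = (\<Sum>F\<in>fiber ` X. \<Sum>\<zeta>\<in>F. h \<zeta>)"
  proof (intro sum.cong refl)
    fix F assume "F \<in> fiber ` X"
    then obtain \<eta> where "\<eta> \<in> X" "F = fiber \<eta>" by blast
    thus "{\<zeta> \<in> X. fiber \<zeta> = F} = F"
      using fiber_self fiber_eq fiber_subset[of \<eta>] by blast
  qed
  finally show ?thesis .
qed

text \<open>On each fiber the weight and \<open>u\<close> are constant while the deviation sums to
  zero.\<close>

lemma inner_deviation:
  assumes "color_blind u"
  shows "ip (\<lambda>\<eta>. f \<eta> - color_mean f \<eta>) u = 0"
proof -
  have "(\<Sum>\<zeta>\<in>F. weight \<zeta> * (f \<zeta> - color_mean f \<zeta>) * u \<zeta>) = 0" if "F \<in> fiber ` X" for F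
  proof -
    from that obtain \<eta> where \<eta>: "\<eta> \<in> X" "F = fiber \<eta>" by blast
    have "(\<Sum>\<zeta>\<in>F. weight \<zeta> * (f \<zeta> - color_mean f \<zeta>) * u \<zeta>)
        = (\<Sum>\<zeta>\<in>F. weight \<eta> * u \<eta> * (f \<zeta> - color_mean f \<zeta>))"
    proof (intro sum.cong refl)
      fix \<zeta> assume "\<zeta> \<in> F"
      hence "weight \<zeta> = weight \<eta>" "u \<zeta> = u \<eta>"
        using weight_fiber color_blind_fiber[OF assms \<eta>(1)] \<eta>(2) by auto
      thus "weight \<zeta> * (f \<zeta> - color_mean f \<zeta>) * u \<zeta> = weight \<eta> * u \<eta> * (f \<zeta> - color_mean f \<zeta>)"
        by (simp only: mult_ac)
    qed
    also have "\<dots> = weight \<eta> * u \<eta> * (\<Sum>\<zeta>\<in>fiber \<eta>. f \<zeta> - color_mean f \<zeta>)"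
      by (simp only: sum_distrib_left \<eta>)
    finally show ?thesis by (simp only: sum_fiber_deviation[OF \<eta>(1)] mult_zero_right)
  qed
  thus ?thesis unfolding weighted_inner_def sum_configs_fiberwise by (rule sum.neutral[OF ballI])
qed

section \<open>Energies of exchanges and of jumps\<close>

definition exchange_energy :: "((nat \<Rightarrow> nat) \<Rightarrow> real) \<Rightarrow> real" where
  "exchange_energy f = (\<Sum>\<eta>\<in>X. \<Sum>k\<in>sites. \<Sum>l\<in>sites.
     weight \<eta> * (occ \<eta> k * occ \<eta> l) * (f (swap \<eta> k l) - f \<eta>)\<^sup>2)"

definition hop_energy :: "((nat \<Rightarrow> nat) \<Rightarrow> real) \<Rightarrow> real" where
  "hop_energy f = (\<Sum>\<eta>\<in>X. \<Sum>k\<in>sites. \<Sum>z\<in>sites.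
     weight \<eta> * (occ \<eta> k * (1 - occ \<eta> z)) * (f (swap \<eta> k z) - f \<eta>)\<^sup>2)"

lemma occ_eq: "occ \<eta> i = (if \<eta> i = 0 then 0 else 1)"
  by (simp add: occ_def Suc_le_eq)

lemma occ_bounds: "0 \<le> occ \<eta> i" "occ \<eta> i \<le> 1"
  by (simp_all add: occ_eq)

lemma sum_occ: "\<eta> \<in> X \<Longrightarrow> (\<Sum>i\<in>sites. occ \<eta> i) = real particles"
proof -
  assume \<eta>: "\<eta> \<in> X"
  have "(\<Sum>i\<in>sites. occ \<eta> i) = (\<Sum>i\<in>sites. if \<eta> i \<noteq> 0 then 1 else 0)"
    by (intro sum.cong refl) (simp add: occ_eq)
  also have "\<dots> = real (card {i \<in> sites. \<eta> i \<noteq> 0})"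
    by (simp add: sum.If_cases Int_def)
  finally show ?thesis by (simp only: card_occupied[OF \<eta>])
qed

lemma sum_empty: "\<eta> \<in> X \<Longrightarrow> (\<Sum>i\<in>sites. 1 - occ \<eta> i) = real N - real particles"
  by (simp only: sum_subtractf sum_occ) simp

lemma sum_occ_mult:
  assumes "A = {i \<in> sites. \<eta> i \<noteq> 0}"
  shows "(\<Sum>k\<in>A. F k) = (\<Sum>k\<in>sites. occ \<eta> k * F k)"
proof -
  have "(\<Sum>k\<in>A. F k) = (\<Sum>k\<in>A. occ \<eta> k * F k)"
    using assms by (intro sum.cong) (auto simp: occ_eq)
  also have "\<dots> = (\<Sum>k\<in>sites. occ \<eta> k * F k)"
    by (rule sum.mono_neutral_left) (use assms in \<open>auto simp: occ_eq\<close>)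
  finally show ?thesis .
qed

text \<open>The fiber is one orbit of the permutations of the occupied sites, so the random
  transposition bound applies with \<open>perm_average\<close> constant on it.\<close>

lemma fiber_variance:
  assumes \<eta>: "\<eta> \<in> X"
  shows "real particles * (\<Sum>\<zeta>\<in>fiber \<eta>. (f \<zeta> - color_mean f \<zeta>)\<^sup>2)
    \<le> (\<Sum>\<zeta>\<in>fiber \<eta>. \<Sum>k\<in>sites. \<Sum>l\<in>sites. occ \<zeta> k * occ \<zeta> l * (f (swap \<zeta> k l) - f \<zeta>)\<^sup>2)"
proof -
  define A where "A = {i \<in> sites. \<eta> i \<noteq> 0}"
  define c where "c = perm_average A f \<eta>"
  define g where "g = color_mean f \<eta>"
  have A: "finite A" "A \<subseteq> sites" "card A = particles"
    using card_occupied[OF \<eta>] by (auto simp: A_def)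
  have empty_iff: "\<eta> i = 0 \<longleftrightarrow> i \<notin> A" for i
    using config_outside[OF \<eta>, of i] unfolding A_def by blast
  have fiberD: "\<zeta> \<in> X" "\<And>i. \<zeta> i = 0 \<longleftrightarrow> i \<notin> A" if "\<zeta> \<in> fiber \<eta>" for \<zeta>
    using that unfolding fiber_def empty_iff by auto
  have closed: "perm_closed A (fiber \<eta>)"
    unfolding perm_closed_def
  proof (intro ballI allI impI)
    fix \<zeta> \<pi> assume \<zeta>: "\<zeta> \<in> fiber \<eta>" and \<pi>: "\<pi> permutes A"
    have "\<zeta> \<circ> \<pi> \<in> X"
      by (rule perm_closedD[OF perm_closed_configs fiberD(1)[OF \<zeta>] permutes_subset[OF \<pi> A(2)]])
    moreover have "(\<zeta> \<circ> \<pi>) i = 0 \<longleftrightarrow> \<eta> i = 0" for i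
      using permutes_in_image[OF \<pi>] by (simp only: o_apply fiberD(2)[OF \<zeta>] empty_iff)
    ultimately show "\<zeta> \<circ> \<pi> \<in> fiber \<eta>" by (simp add: fiber_def)
  qed
  have const: "perm_average A f \<zeta> = c" if \<zeta>: "\<zeta> \<in> fiber \<eta>" for \<zeta>
  proof -
    have "\<zeta> i = \<eta> i" if "i \<notin> A" for i
      using that fiberD(2)[OF \<zeta>, of i] empty_iff[of i] by simp
    from configs_transitive[OF fiberD(1)[OF \<zeta>] \<eta> A(2) this]
    obtain \<pi> where \<pi>: "\<pi> permutes A" "\<zeta> = \<eta> \<circ> \<pi>" .
    show ?thesis unfolding \<pi>(2) c_def by (rule perm_average_invariant[OF \<pi>(1)])
  qed
  have mean: "(\<Sum>\<zeta>\<in>fiber \<eta>. f \<zeta> - g) = 0"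
  proof -
    have "(\<Sum>\<zeta>\<in>fiber \<eta>. f \<zeta> - g) = (\<Sum>\<zeta>\<in>fiber \<eta>. f \<zeta> - color_mean f \<zeta>)"
      by (intro sum.cong refl) (simp only: g_def color_mean_fiber)
    thus ?thesis by (simp only: sum_fiber_deviation[OF \<eta>])
  qed
  \<comment> \<open>The mean minimizes the squared deviation, so the constant c need not be
    identified with it.\<close>
  have "(\<Sum>\<zeta>\<in>fiber \<eta>. (f \<zeta> - c)\<^sup>2)
      = (\<Sum>\<zeta>\<in>fiber \<eta>. (f \<zeta> - g)\<^sup>2 + (g - c)\<^sup>2 + 2 * (g - c) * (f \<zeta> - g))"
    by (intro sum.cong refl) (simp add: power2_eq_square algebra_simps)
  also have "\<dots> = (\<Sum>\<zeta>\<in>fiber \<eta>. (f \<zeta> - g)\<^sup>2) + real (card (fiber \<eta>)) * (g - c)\<^sup>2"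
    unfolding sum.distrib sum_distrib_left[symmetric] mean by simp
  finally have "(\<Sum>\<zeta>\<in>fiber \<eta>. (f \<zeta> - g)\<^sup>2) \<le> (\<Sum>\<zeta>\<in>fiber \<eta>. (f \<zeta> - c)\<^sup>2)" by simp
  moreover have "(\<Sum>\<zeta>\<in>fiber \<eta>. (f \<zeta> - c)\<^sup>2) = (\<Sum>\<zeta>\<in>fiber \<eta>. (f \<zeta> - perm_average A f \<zeta>)\<^sup>2)"
    by (intro sum.cong refl) (simp only: const)
  moreover have "(\<Sum>\<zeta>\<in>fiber \<eta>. (f \<zeta> - color_mean f \<zeta>)\<^sup>2) = (\<Sum>\<zeta>\<in>fiber \<eta>. (f \<zeta> - g)\<^sup>2)"
    by (intro sum.cong refl) (simp only: g_def color_mean_fiber)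
  ultimately have "real particles * (\<Sum>\<zeta>\<in>fiber \<eta>. (f \<zeta> - color_mean f \<zeta>)\<^sup>2)
      \<le> real particles * (\<Sum>\<zeta>\<in>fiber \<eta>. (f \<zeta> - perm_average A f \<zeta>)\<^sup>2)"
    by (intro mult_left_mono[OF _ of_nat_0_le_iff]) simp
  also have "\<dots> \<le> (\<Sum>k\<in>A. \<Sum>l\<in>A. \<Sum>\<zeta>\<in>fiber \<eta>. (f (swap \<zeta> k l) - f \<zeta>)\<^sup>2)"
    using random_transposition_gap[OF A(1) closed] by (simp only: A(3))
  also have "\<dots> = (\<Sum>\<zeta>\<in>fiber \<eta>. \<Sum>k\<in>A. \<Sum>l\<in>A. (f (swap \<zeta> k l) - f \<zeta>)\<^sup>2)"
    by (simp only: sum.swap[of _ _ "fiber \<eta>"])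
  also have "\<dots> = (\<Sum>\<zeta>\<in>fiber \<eta>. \<Sum>k\<in>sites. \<Sum>l\<in>sites. occ \<zeta> k * occ \<zeta> l * (f (swap \<zeta> k l) - f \<zeta>)\<^sup>2)"
  proof (rule sum.cong[OF refl])
    fix \<zeta> assume \<zeta>: "\<zeta> \<in> fiber \<eta>"
    have A_eq: "A = {i \<in> sites. \<zeta> i \<noteq> 0}" using A(2) by (auto simp: fiberD(2)[OF \<zeta>] simp del: neq0_conv)
    have "(\<Sum>k\<in>A. \<Sum>l\<in>A. (f (swap \<zeta> k l) - f \<zeta>)\<^sup>2)
        = (\<Sum>k\<in>sites. occ \<zeta> k * (\<Sum>l\<in>A. (f (swap \<zeta> k l) - f \<zeta>)\<^sup>2))"
      by (rule sum_occ_mult[OF A_eq])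
    also have "\<dots> = (\<Sum>k\<in>sites. occ \<zeta> k * (\<Sum>l\<in>sites. occ \<zeta> l * (f (swap \<zeta> k l) - f \<zeta>)\<^sup>2))"
      by (simp only: sum_occ_mult[OF A_eq])
    finally show "(\<Sum>k\<in>A. \<Sum>l\<in>A. (f (swap \<zeta> k l) - f \<zeta>)\<^sup>2)
        = (\<Sum>k\<in>sites. \<Sum>l\<in>sites. occ \<zeta> k * occ \<zeta> l * (f (swap \<zeta> k l) - f \<zeta>)\<^sup>2)"
      by (simp only: sum_distrib_left mult.assoc)
  qed
  finally show ?thesis .
qed

lemma deviation_le_exchange:
  "real particles * ip (\<lambda>\<eta>. f \<eta> - color_mean f \<eta>) (\<lambda>\<eta>. f \<eta> - color_mean f \<eta>) \<le> exchange_energy f"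
proof -
  let ?e = "\<lambda>\<zeta>. \<Sum>k\<in>sites. \<Sum>l\<in>sites. occ \<zeta> k * occ \<zeta> l * (f (swap \<zeta> k l) - f \<zeta>)\<^sup>2"
  have "real particles * ip (\<lambda>\<eta>. f \<eta> - color_mean f \<eta>) (\<lambda>\<eta>. f \<eta> - color_mean f \<eta>)
      = (\<Sum>\<eta>\<in>X. weight \<eta> * (real particles * (f \<eta> - color_mean f \<eta>)\<^sup>2))"
    unfolding weighted_inner_def sum_distrib_left
    by (intro sum.cong refl) (simp only: power2_eq_square mult_ac)
  also have "\<dots> \<le> (\<Sum>\<eta>\<in>X. weight \<eta> * ?e \<eta>)"
    unfolding sum_configs_fiberwise
  proof (rule sum_mono)
    fix F assume "F \<in> fiber ` X"
    then obtain \<eta> where \<eta>: "\<eta> \<in> X" and F: "F = fiber \<eta>" by blast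
    have const: "(\<Sum>\<zeta>\<in>F. weight \<zeta> * u \<zeta>) = weight \<eta> * (\<Sum>\<zeta>\<in>F. u \<zeta>)" for u
      unfolding sum_distrib_left F by (intro sum.cong refl) (simp only: weight_fiber)
    show "(\<Sum>\<zeta>\<in>F. weight \<zeta> * (real particles * (f \<zeta> - color_mean f \<zeta>)\<^sup>2)) \<le> (\<Sum>\<zeta>\<in>F. weight \<zeta> * ?e \<zeta>)"
      unfolding const sum_distrib_left[symmetric]
      by (rule mult_left_mono[OF _ weight_nonneg]) (unfold F, rule fiber_variance[OF \<eta>])
  qed
  also have "\<dots> = exchange_energy f"
    unfolding exchange_energy_def sum_distrib_left by (simp only: mult_ac)
  finally show ?thesis .
qed

lemma dirichlet_square:
  "dirichlet \<gamma> f f = (\<Sum>\<eta>\<in>X. \<Sum>i\<in>sites. \<Sum>j\<in>sites.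
     weight \<eta> * rate \<gamma> p i j \<eta> * (f (swap \<eta> i j) - f \<eta>)\<^sup>2) / (4 * real N)"
  unfolding dirichlet_def power2_eq_square by (simp only: sum.swap[of _ _ X])

text \<open>For \<gamma> = 1 two particles exchange at rate 1/2; together with the denominator
  \<open>4 * N\<close> this gives 8.\<close>

lemma exchange_le_dirichlet: "exchange_energy f \<le> 8 * real N * dirichlet 1 f f"
proof -
  have "exchange_energy f \<le> (\<Sum>\<eta>\<in>X. \<Sum>i\<in>sites. \<Sum>j\<in>sites.
      2 * (weight \<eta> * rate 1 p i j \<eta> * (f (swap \<eta> i j) - f \<eta>)\<^sup>2))"
    unfolding exchange_energy_def
  proof (intro sum_mono)
    fix \<eta> i j assume ij: "i \<in> sites" "j \<in> sites"
    have "occ \<eta> i * occ \<eta> j \<le> 2 * rate 1 p i j \<eta>"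
      using base_rate_bounds(1)[OF ij, of \<eta>] by (auto simp: rate_def occ_eq)
    hence "weight \<eta> * (f (swap \<eta> i j) - f \<eta>)\<^sup>2 * (occ \<eta> i * occ \<eta> j)
        \<le> weight \<eta> * (f (swap \<eta> i j) - f \<eta>)\<^sup>2 * (2 * rate 1 p i j \<eta>)"
      by (rule mult_left_mono) (simp add: weight_nonneg)
    thus "weight \<eta> * (occ \<eta> i * occ \<eta> j) * (f (swap \<eta> i j) - f \<eta>)\<^sup>2
        \<le> 2 * (weight \<eta> * rate 1 p i j \<eta> * (f (swap \<eta> i j) - f \<eta>)\<^sup>2)"
      by (simp only: mult_ac)
  qed
  also have "\<dots> = 2 * (\<Sum>\<eta>\<in>X. \<Sum>i\<in>sites. \<Sum>j\<in>sites.
      weight \<eta> * rate 1 p i j \<eta> * (f (swap \<eta> i j) - f \<eta>)\<^sup>2)"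
    by (simp only: sum_distrib_left)
  also have "\<dots> = 8 * real N * dirichlet 1 f f"
    using N_ge_2 unfolding dirichlet_square by simp
  finally show ?thesis .
qed

text \<open>Particle-hole exchanges have rate at least \<open>\<epsilon>\<^sup>2\<close>. The form
  contains each of them in both orders, the jump energy only with the particle first.\<close>

lemma hop_le_dirichlet: "\<epsilon>\<^sup>2 * hop_energy f \<le> 4 * real N * dirichlet 0 f f"
proof -
  have "\<epsilon>\<^sup>2 * hop_energy f \<le> (\<Sum>\<eta>\<in>X. \<Sum>i\<in>sites. \<Sum>j\<in>sites.
      weight \<eta> * rate 0 p i j \<eta> * (f (swap \<eta> i j) - f \<eta>)\<^sup>2)"
    unfolding hop_energy_def sum_distrib_left
  proof (intro sum_mono)
    fix \<eta> i j assume ij: "i \<in> sites" "j \<in> sites"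
    have "\<epsilon>\<^sup>2 * (occ \<eta> i * (1 - occ \<eta> j)) \<le> rate 0 p i j \<eta>"
      using base_rate_bounds(1)[OF ij, of \<eta>] base_rate_ge[OF ij, of \<eta>] by (auto simp: rate_def occ_eq)
    hence "weight \<eta> * (f (swap \<eta> i j) - f \<eta>)\<^sup>2 * (\<epsilon>\<^sup>2 * (occ \<eta> i * (1 - occ \<eta> j)))
        \<le> weight \<eta> * (f (swap \<eta> i j) - f \<eta>)\<^sup>2 * rate 0 p i j \<eta>"
      by (rule mult_left_mono) (simp add: weight_nonneg)
    thus "\<epsilon>\<^sup>2 * (weight \<eta> * (occ \<eta> i * (1 - occ \<eta> j)) * (f (swap \<eta> i j) - f \<eta>)\<^sup>2)
        \<le> weight \<eta> * rate 0 p i j \<eta> * (f (swap \<eta> i j) - f \<eta>)\<^sup>2"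
      by (simp only: mult_ac)
  qed
  also have "\<dots> = 4 * real N * dirichlet 0 f f"
    using N_ge_2 unfolding dirichlet_square by simp
  finally show ?thesis .
qed

lemma dirichlet_mono: "dirichlet 0 f f \<le> dirichlet 1 f f"
  unfolding dirichlet_square
  by (intro divide_right_mono sum_mono mult_right_mono mult_left_mono weight_nonneg)
     (simp_all add: rate_def)

text \<open>Two particles at \<open>k\<close> and \<open>l\<close> are exchanged by three jumps through a hole \<open>z\<close>. Averaging
  over all holes spreads the load evenly, and summing over the particle not involved in a given
  jump produces the factor \<open>particles\<close> that compensates the small gap at low density.\<close>

lemma exchange_le_hop:
  "(real N - real particles) * exchange_energy f
    \<le> 3 * (1 + 2 / \<epsilon>\<^sup>2) * real particles * hop_energy f"
proof -
  let ?n = "real particles"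
  define e where "e = 1 / \<epsilon>\<^sup>2"
  define R where "R \<eta> i j = weight \<eta> * (occ \<eta> i * (1 - occ \<eta> j)) * (f (swap \<eta> i j) - f \<eta>)\<^sup>2" for \<eta> i j
  have e: "0 \<le> e" by (simp add: e_def)
  have weight_le: "weight \<eta> \<le> e * weight (swap \<eta> i j)" if "i \<in> sites" "j \<in> sites" for \<eta> i j
    using weight_swap_ge[OF that, of \<eta>] eps_pos by (simp add: e_def pos_le_divide_eq mult.commute)
  have R_nonneg: "0 \<le> R \<eta> i j" for \<eta> i j
    by (simp add: R_def weight_nonneg occ_bounds)
  \<comment> \<open>The jumps are k to z, then l to k, then z to l; the last is read backwards, as a
    jump from l to z out of the exchanged configuration. The remaining factor \<open>occ\<close>
    records the idle particle, located at l, z and k respectively. Changing the base configuration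
    costs \<open>e\<close> through \<open>weight_swap_ge\<close>.\<close>
  have pointwise: "weight \<eta> * (occ \<eta> k * occ \<eta> l) * (f (swap \<eta> k l) - f \<eta>)\<^sup>2 * (1 - occ \<eta> z)
      \<le> 3 * (occ \<eta> l * R \<eta> k z + e * (occ (swap \<eta> k z) z * R (swap \<eta> k z) l k)
        + e * (occ (swap \<eta> k l) k * R (swap \<eta> k l) l z))" (is "?L \<le> 3 * (?A + ?B + ?C)")
    if kz: "k \<in> sites" "l \<in> sites" "z \<in> sites" for \<eta> k l z
  proof (cases "\<eta> k \<noteq> 0 \<and> \<eta> l \<noteq> 0 \<and> \<eta> z = 0 \<and> k \<noteq> l")
    case False
    hence no_jump: "?L = 0" by (auto simp: occ_eq)
    have "0 \<le> ?A + ?B + ?C" by (simp add: e R_nonneg occ_bounds)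
    thus ?thesis unfolding no_jump by (rule mult_nonneg_nonneg[OF zero_le_numeral])
  next
    case True
    hence neq: "k \<noteq> l" "k \<noteq> z" "l \<noteq> z" by auto
    define \<zeta> where "\<zeta> = swap \<eta> k z"
    define \<xi> where "\<xi> = swap \<eta> k l"
    have occs: "occ \<eta> k = 1" "occ \<eta> l = 1" "occ \<eta> z = 0" "occ \<zeta> z = 1" "occ \<zeta> l = 1" "occ \<zeta> k = 0"
        "occ \<xi> k = 1" "occ \<xi> l = 1" "occ \<xi> z = 0"
      using True neq by (auto simp: occ_eq \<zeta>_def \<xi>_def transpose_apply_other)
    have path: "swap \<zeta> l k = swap \<xi> l z"
      unfolding \<zeta>_def \<xi>_def using neq by (auto simp: fun_eq_iff Transposition.transpose_def)
    let ?a = "f \<zeta> - f \<eta>" and ?b = "f (swap \<zeta> l k) - f \<zeta>" and ?c = "f \<xi> - f (swap \<xi> l z)"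
    have "(f \<xi> - f \<eta>)\<^sup>2 = (?a + ?b + ?c)\<^sup>2" by (simp add: path)
    also have "\<dots> \<le> 3 * (?a\<^sup>2 + ?b\<^sup>2 + ?c\<^sup>2)"
    proof -
      have "0 \<le> (?a - ?b)\<^sup>2 + (?b - ?c)\<^sup>2 + (?a - ?c)\<^sup>2" by simp
      thus ?thesis by (simp add: power2_eq_square algebra_simps)
    qed
    finally have "weight \<eta> * (f \<xi> - f \<eta>)\<^sup>2 \<le> weight \<eta> * (3 * (?a\<^sup>2 + ?b\<^sup>2 + ?c\<^sup>2))"
      by (rule mult_left_mono[OF _ weight_nonneg])
    also have "\<dots> = 3 * (weight \<eta> * ?a\<^sup>2 + weight \<eta> * ?b\<^sup>2 + weight \<eta> * ?c\<^sup>2)"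
      by (simp only: distrib_left mult_ac)
    also have "\<dots> \<le> 3 * (weight \<eta> * ?a\<^sup>2 + e * weight \<zeta> * ?b\<^sup>2 + e * weight \<xi> * ?c\<^sup>2)"
      using weight_le[OF kz(1,3), of \<eta>] weight_le[OF kz(1,2), of \<eta>]
      unfolding \<zeta>_def[symmetric] \<xi>_def[symmetric]
      by (intro mult_left_mono add_mono mult_right_mono) simp_all
    also have "\<dots> = 3 * (occ \<eta> l * R \<eta> k z + e * (occ \<zeta> z * R \<zeta> l k) + e * (occ \<xi> k * R \<xi> l z))"
      unfolding R_def occs \<zeta>_def[symmetric] by (simp add: power2_commute mult.assoc)
    finally show ?thesis
      unfolding \<zeta>_def[symmetric] \<xi>_def[symmetric] occs by simp
  qed
  have swap_in: "(\<Sum>\<eta>\<in>X. \<Sum>k\<in>sites. \<Sum>l\<in>sites. \<Sum>z\<in>sites. G \<eta> k l z)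
      = (\<Sum>k\<in>sites. \<Sum>l\<in>sites. \<Sum>z\<in>sites. \<Sum>\<eta>\<in>X. G \<eta> k l z)" for G :: "_ \<Rightarrow> _ \<Rightarrow> _ \<Rightarrow> _ \<Rightarrow> real"
    by (simp only: sum.swap[of _ _ X])
  have S1: "(\<Sum>\<eta>\<in>X. \<Sum>k\<in>sites. \<Sum>l\<in>sites. \<Sum>z\<in>sites. occ \<eta> l * R \<eta> k z) = ?n * hop_energy f"
  proof -
    have "(\<Sum>k\<in>sites. \<Sum>l\<in>sites. \<Sum>z\<in>sites. occ \<eta> l * R \<eta> k z)
        = ?n * (\<Sum>k\<in>sites. \<Sum>z\<in>sites. R \<eta> k z)" if "\<eta> \<in> X" for \<eta>
      by (subst sum.swap) (simp only: sum_triple_factor sum_occ[OF that])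
    hence "(\<Sum>\<eta>\<in>X. \<Sum>k\<in>sites. \<Sum>l\<in>sites. \<Sum>z\<in>sites. occ \<eta> l * R \<eta> k z)
        = (\<Sum>\<eta>\<in>X. ?n * (\<Sum>k\<in>sites. \<Sum>z\<in>sites. R \<eta> k z))"
      by (intro sum.cong refl)
    also have "\<dots> = ?n * hop_energy f"
      unfolding hop_energy_def R_def[symmetric] by (simp only: sum_distrib_left)
    finally show ?thesis .
  qed
  \<comment> \<open>After reindexing by the exchange, the jump involves only l and k, so the sum
    over z counts the positions of the idle particle and gives n. In the same way n comes from l in
    \<open>S1\<close> and from k in \<open>S3\<close>.\<close>
  have S2: "(\<Sum>\<eta>\<in>X. \<Sum>k\<in>sites. \<Sum>l\<in>sites. \<Sum>z\<in>sites. occ (swap \<eta> k z) z * R (swap \<eta> k z) l k) = ?n * hop_energy f"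
  proof -
    have "(\<Sum>\<eta>\<in>X. \<Sum>k\<in>sites. \<Sum>l\<in>sites. \<Sum>z\<in>sites. occ (swap \<eta> k z) z * R (swap \<eta> k z) l k)
        = (\<Sum>\<eta>\<in>X. \<Sum>k\<in>sites. \<Sum>l\<in>sites. \<Sum>z\<in>sites. occ \<eta> z * R \<eta> l k)"
      unfolding swap_in
    proof (rule sum.cong[OF refl], rule sum.cong[OF refl], rule sum.cong[OF refl])
      fix k l z assume "k \<in> sites" "z \<in> sites"
      thus "(\<Sum>\<eta>\<in>X. occ (swap \<eta> k z) z * R (swap \<eta> k z) l k) = (\<Sum>\<eta>\<in>X. occ \<eta> z * R \<eta> l k)"
        by (rule sum_comp_swap[OF perm_closed_configs, of _ _ "\<lambda>\<eta>. occ \<eta> z * R \<eta> l k"])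
    qed
    also have "\<dots> = (\<Sum>\<eta>\<in>X. ?n * (\<Sum>l\<in>sites. \<Sum>k\<in>sites. R \<eta> l k))"
    proof (intro sum.cong refl)
      fix \<eta> assume \<eta>: "\<eta> \<in> X"
      have "(\<Sum>k\<in>sites. \<Sum>l\<in>sites. \<Sum>z\<in>sites. occ \<eta> z * R \<eta> l k)
          = (\<Sum>z\<in>sites. occ \<eta> z) * (\<Sum>k\<in>sites. \<Sum>l\<in>sites. R \<eta> l k)"
        by (simp only: sum_distrib_left[symmetric] sum_distrib_right[symmetric])
      also have "(\<Sum>k\<in>sites. \<Sum>l\<in>sites. R \<eta> l k) = (\<Sum>l\<in>sites. \<Sum>k\<in>sites. R \<eta> l k)" by (rule sum.swap)
      finally show "(\<Sum>k\<in>sites. \<Sum>l\<in>sites. \<Sum>z\<in>sites. occ \<eta> z * R \<eta> l k) = ?n * (\<Sum>l\<in>sites. \<Sum>k\<in>sites. R \<eta> l k)"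
        by (simp only: sum_occ[OF \<eta>])
    qed
    also have "\<dots> = ?n * hop_energy f"
      unfolding hop_energy_def R_def[symmetric] by (simp only: sum_distrib_left)
    finally show ?thesis .
  qed
  have S3: "(\<Sum>\<eta>\<in>X. \<Sum>k\<in>sites. \<Sum>l\<in>sites. \<Sum>z\<in>sites. occ (swap \<eta> k l) k * R (swap \<eta> k l) l z) = ?n * hop_energy f"
  proof -
    have "(\<Sum>\<eta>\<in>X. \<Sum>k\<in>sites. \<Sum>l\<in>sites. \<Sum>z\<in>sites. occ (swap \<eta> k l) k * R (swap \<eta> k l) l z)
        = (\<Sum>\<eta>\<in>X. \<Sum>k\<in>sites. \<Sum>l\<in>sites. \<Sum>z\<in>sites. occ \<eta> k * R \<eta> l z)"
      unfolding swap_in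
    proof (rule sum.cong[OF refl], rule sum.cong[OF refl], rule sum.cong[OF refl])
      fix k l z assume "k \<in> sites" "l \<in> sites"
      thus "(\<Sum>\<eta>\<in>X. occ (swap \<eta> k l) k * R (swap \<eta> k l) l z) = (\<Sum>\<eta>\<in>X. occ \<eta> k * R \<eta> l z)"
        by (rule sum_comp_swap[OF perm_closed_configs, of _ _ "\<lambda>\<eta>. occ \<eta> k * R \<eta> l z"])
    qed
    also have "\<dots> = (\<Sum>\<eta>\<in>X. ?n * (\<Sum>l\<in>sites. \<Sum>z\<in>sites. R \<eta> l z))"
      by (intro sum.cong refl) (simp only: sum_triple_factor sum_occ)
    also have "\<dots> = ?n * hop_energy f"
      unfolding hop_energy_def R_def[symmetric] by (simp only: sum_distrib_left)
    finally show ?thesis .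
  qed
  have "(real N - ?n) * exchange_energy f = (\<Sum>\<eta>\<in>X. \<Sum>k\<in>sites. \<Sum>l\<in>sites. \<Sum>z\<in>sites.
      weight \<eta> * (occ \<eta> k * occ \<eta> l) * (f (swap \<eta> k l) - f \<eta>)\<^sup>2 * (1 - occ \<eta> z))"
    unfolding exchange_energy_def sum_distrib_left[of "real N - ?n"]
    by (intro sum.cong refl) (simp only: sum_distrib_left[symmetric] sum_empty, simp only: mult.commute)
  also have "\<dots> \<le> (\<Sum>\<eta>\<in>X. \<Sum>k\<in>sites. \<Sum>l\<in>sites. \<Sum>z\<in>sites.
      3 * (occ \<eta> l * R \<eta> k z + e * (occ (swap \<eta> k z) z * R (swap \<eta> k z) l k)
        + e * (occ (swap \<eta> k l) k * R (swap \<eta> k l) l z)))"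
    by (intro sum_mono pointwise)
  also have "\<dots> = 3 * ((\<Sum>\<eta>\<in>X. \<Sum>k\<in>sites. \<Sum>l\<in>sites. \<Sum>z\<in>sites. occ \<eta> l * R \<eta> k z)
      + e * (\<Sum>\<eta>\<in>X. \<Sum>k\<in>sites. \<Sum>l\<in>sites. \<Sum>z\<in>sites. occ (swap \<eta> k z) z * R (swap \<eta> k z) l k)
      + e * (\<Sum>\<eta>\<in>X. \<Sum>k\<in>sites. \<Sum>l\<in>sites. \<Sum>z\<in>sites. occ (swap \<eta> k l) k * R (swap \<eta> k l) l z))"
    by (simp only: sum_distrib_left distrib_left sum.distrib)
  also have "\<dots> = 3 * (?n * hop_energy f + e * (?n * hop_energy f) + e * (?n * hop_energy f))"
    unfolding S1 S2 S3 ..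
  also have "\<dots> = 3 * (1 + 2 / \<epsilon>\<^sup>2) * ?n * hop_energy f"
    by (simp add: e_def algebra_simps)
  finally show ?thesis .
qed

section \<open>Spectral gap\<close>

lemma dirichlet_add_right: "dirichlet \<gamma> f (\<lambda>\<eta>. u \<eta> + v \<eta>) = dirichlet \<gamma> f u + dirichlet \<gamma> f v"
proof -
  have "weight \<eta> * rate \<gamma> p i j \<eta> * ((f (swap \<eta> i j) - f \<eta>) * (u (swap \<eta> i j) + v (swap \<eta> i j) - (u \<eta> + v \<eta>)))
      = weight \<eta> * rate \<gamma> p i j \<eta> * ((f (swap \<eta> i j) - f \<eta>) * (u (swap \<eta> i j) - u \<eta>))
        + weight \<eta> * rate \<gamma> p i j \<eta> * ((f (swap \<eta> i j) - f \<eta>) * (v (swap \<eta> i j) - v \<eta>))" for \<eta> i j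
    by (simp only: algebra_simps)
  thus ?thesis unfolding dirichlet_def by (simp only: sum.distrib add_divide_distrib)
qed

text \<open>The cross term is minus the inner product of the deviation with the generator applied to
  the color mean. The latter is \<open>color_blind\<close>, so the term vanishes and only the
  nonnegative form of the deviation is dropped.\<close>

lemma dirichlet_color_mean: "dirichlet 0 (color_mean f) (color_mean f) \<le> dirichlet 0 f f"
proof -
  define g where "g = color_mean f"
  define h where "h = (\<lambda>\<eta>. f \<eta> - g \<eta>)"
  have f: "f = (\<lambda>\<eta>. g \<eta> + h \<eta>)" by (simp add: h_def)
  have "ip h (gen 0 g) = 0"
    unfolding h_def g_def by (intro inner_deviation color_blind_gen color_blind_color_mean)
  hence hg: "dirichlet 0 h g = 0" by (simp add: inner_gen)
  hence gh: "dirichlet 0 g h = 0" by (simp only: dirichlet_commute[of 0 g h])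
  have "dirichlet 0 f f = dirichlet 0 f g + dirichlet 0 f h"
    by (subst (2) f) (rule dirichlet_add_right)
  also have "dirichlet 0 f g = dirichlet 0 g g"
    by (subst dirichlet_commute, subst f) (simp only: dirichlet_add_right gh add_0_right)
  also have "dirichlet 0 f h = dirichlet 0 h h"
    by (subst dirichlet_commute, subst f) (simp only: dirichlet_add_right hg add_0_left)
  finally show ?thesis using dirichlet_nonneg[of 0 h] by (simp add: g_def)
qed

lemma inner_decomposition:
  "ip f f = ip (color_mean f) (color_mean f)
    + ip (\<lambda>\<eta>. f \<eta> - color_mean f \<eta>) (\<lambda>\<eta>. f \<eta> - color_mean f \<eta>)"
proof -
  define g where "g = color_mean f"
  define h where "h = (\<lambda>\<eta>. f \<eta> - g \<eta>)"
  have f: "f = (\<lambda>\<eta>. g \<eta> + h \<eta>)" by (simp add: h_def)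
  have hg: "ip h g = 0"
    unfolding h_def g_def by (intro inner_deviation color_blind_color_mean)
  hence gh: "ip g h = 0" by (simp only: weighted_inner_commute[of X weight g h])
  have "ip f f = ip f g + ip f h" by (subst (2) f) (rule weighted_inner_add_right)
  also have "ip f g = ip g g"
    by (subst weighted_inner_commute, subst f) (simp only: weighted_inner_add_right gh add_0_right)
  also have "ip f h = ip h h"
    by (subst weighted_inner_commute, subst f) (simp only: weighted_inner_add_right hg add_0_left)
  finally show ?thesis by (simp only: g_def h_def)
qed

lemma color_mean_gap:
  assumes "(\<Sum>\<eta>\<in>X. weight \<eta> * f \<eta>) = 0"
  shows "ip (color_mean f) (color_mean f) \<le> 2 / \<epsilon>\<^sup>2 * dirichlet 0 f f"
proof -
  have "ip (\<lambda>\<eta>. f \<eta> - color_mean f \<eta>) (\<lambda>_. 1) = 0"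
    by (rule inner_deviation) (simp add: color_blind_def)
  hence "(\<Sum>\<eta>\<in>X. weight \<eta> * color_mean f \<eta>) = 0"
    using assms by (simp add: weighted_inner_def right_diff_distrib sum_subtractf)
  from color_blind_gap[OF color_blind_color_mean this] dirichlet_color_mean[of f]
  have "\<epsilon>\<^sup>2 / 2 * ip (color_mean f) (color_mean f) \<le> dirichlet 0 f f" by (rule order_trans)
  thus ?thesis using eps_pos by (simp add: field_simps)
qed

abbreviation "\<rho> \<equiv> global_density m N \<omega>"

lemma density_eq: "\<rho> = real particles / real N"
  by (simp add: global_density_def)

lemma density_bounds: "0 < \<rho>" "\<rho> < 1"
  using particles_pos particles_less unfolding density_eq by (simp_all del: of_nat_sum)

text \<open>Both sides of the chain carry a factor n, from the transposition bound and from
  \<open>exchange_le_hop\<close>; cancelling it makes the estimate uniform at low density. The 12 is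
  the 3 of the three-jump path times the 4 of \<open>dirichlet\<close>.\<close>

lemma deviation_bound_hop:
  "(1 - \<rho>) * ip (\<lambda>\<eta>. f \<eta> - color_mean f \<eta>) (\<lambda>\<eta>. f \<eta> - color_mean f \<eta>)
    \<le> 12 * (1 + 2 / \<epsilon>\<^sup>2) / \<epsilon>\<^sup>2 * dirichlet 0 f f"
proof -
  define n where "n = real particles"
  define d where "d = dirichlet 0 f f"
  define v where "v = ip (\<lambda>\<eta>. f \<eta> - color_mean f \<eta>) (\<lambda>\<eta>. f \<eta> - color_mean f \<eta>)"
  have n: "0 < n" "n < real N"
    using particles_pos particles_less by (simp_all only: n_def of_nat_less_iff of_nat_0_less_iff)
  have "n * ((real N - n) * v) = (real N - n) * (n * v)" by (simp only: mult_ac)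
  also have "\<dots> \<le> (real N - n) * exchange_energy f"
    unfolding v_def by (rule mult_left_mono[OF deviation_le_exchange[of f, folded n_def]]) (use n in simp)
  also have "\<dots> \<le> 3 * (1 + 2 / \<epsilon>\<^sup>2) * n * hop_energy f"
    unfolding n_def by (rule exchange_le_hop)
  also have "\<dots> = n * (3 * (1 + 2 / \<epsilon>\<^sup>2) * hop_energy f)" by (simp only: mult_ac)
  finally have "(real N - n) * v \<le> 3 * (1 + 2 / \<epsilon>\<^sup>2) * hop_energy f"
    using n(1) by (simp only: mult_le_cancel_left_pos)
  also have "\<dots> \<le> 3 * (1 + 2 / \<epsilon>\<^sup>2) * (4 * real N * d / \<epsilon>\<^sup>2)"
    using hop_le_dirichlet[of f] eps_pos
    by (intro mult_left_mono) (simp_all add: d_def pos_le_divide_eq mult.commute)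
  also have "\<dots> = real N * (12 * (1 + 2 / \<epsilon>\<^sup>2) / \<epsilon>\<^sup>2 * d)" by simp
  finally have "real N * ((1 - \<rho>) * v) \<le> real N * (12 * (1 + 2 / \<epsilon>\<^sup>2) / \<epsilon>\<^sup>2 * d)"
    using n unfolding density_eq n_def[symmetric] by (simp add: algebra_simps)
  thus ?thesis using n by (simp only: mult_le_cancel_left_pos d_def v_def)
qed

lemma deviation_bound_exchange:
  "\<rho> * ip (\<lambda>\<eta>. f \<eta> - color_mean f \<eta>) (\<lambda>\<eta>. f \<eta> - color_mean f \<eta>) \<le> 8 * dirichlet 1 f f"
proof -
  have "real N * \<rho> = real particles" using N_ge_2 unfolding density_eq by simp
  hence "real N * (\<rho> * ip (\<lambda>\<eta>. f \<eta> - color_mean f \<eta>) (\<lambda>\<eta>. f \<eta> - color_mean f \<eta>))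
      \<le> real N * (8 * dirichlet 1 f f)"
    using deviation_le_exchange[of f] exchange_le_dirichlet[of f]
    by (simp only: mult.assoc[symmetric])
  moreover have "0 < real N" using N_ge_2 by simp
  ultimately show ?thesis by (simp only: mult_le_cancel_left_pos)
qed

text \<open>The constant of \<open>color_mean_gap\<close> plus that of
  \<open>deviation_bound_hop\<close>.\<close>

definition gap_scale :: real where
  "gap_scale = 2 / \<epsilon>\<^sup>2 + 12 * (1 + 2 / \<epsilon>\<^sup>2) / \<epsilon>\<^sup>2"

lemma gap_scale_ge: "2 / \<epsilon>\<^sup>2 + 12 \<le> gap_scale"
proof -
  have "\<epsilon>\<^sup>2 \<le> 1" using eps_pos eps_less by (simp add: power_le_one)
  hence "1 \<le> 1 / \<epsilon>\<^sup>2" using eps_pos by simp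
  hence "12 * 1 \<le> 12 * (1 + 2 / \<epsilon>\<^sup>2) * (1 / \<epsilon>\<^sup>2)" by (intro mult_mono) auto
  thus ?thesis by (simp add: gap_scale_def)
qed

lemma gap_scale_pos: "0 < gap_scale"
proof -
  have "0 \<le> 2 / \<epsilon>\<^sup>2" by simp
  thus ?thesis using gap_scale_ge by linarith
qed

theorem poincare_hop:
  assumes "(\<Sum>\<eta>\<in>X. weight \<eta> * f \<eta>) = 0"
  shows "(1 - \<rho>) * ip f f \<le> gap_scale * dirichlet 0 f f"
proof -
  have "(1 - \<rho>) * ip (color_mean f) (color_mean f) \<le> 1 * (2 / \<epsilon>\<^sup>2 * dirichlet 0 f f)"
    by (rule mult_mono) (use density_bounds color_mean_gap[OF assms] dirichlet_nonneg[of 0 f] weight_nonneg in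
      \<open>auto simp: weighted_inner_def mult.assoc intro!: sum_nonneg\<close>)
  thus ?thesis using deviation_bound_hop[of f]
    unfolding inner_decomposition[of f] gap_scale_def by (simp add: distrib_left distrib_right)
qed

text \<open>At density at most 1/2 the estimate through holes loses only a factor 2. Above 1/2 the
  direct exchanges control the deviation, with 16 = 8 / (1/2).\<close>

theorem poincare_exchange:
  assumes "(\<Sum>\<eta>\<in>X. weight \<eta> * f \<eta>) = 0"
  shows "ip f f \<le> 2 * gap_scale * dirichlet 1 f f"
proof (cases "\<rho> \<le> 1 / 2")
  case True
  have "0 \<le> ip f f" using weight_nonneg by (auto simp: weighted_inner_def mult.assoc intro!: sum_nonneg)
  hence "1 / 2 * ip f f \<le> (1 - \<rho>) * ip f f"
    by (rule mult_right_mono[rotated]) (use True in simp)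
  also have "\<dots> \<le> gap_scale * dirichlet 0 f f" by (rule poincare_hop[OF assms])
  also have "\<dots> \<le> gap_scale * dirichlet 1 f f"
    by (rule mult_left_mono[OF dirichlet_mono]) (use gap_scale_pos in simp)
  finally show ?thesis by simp
next
  case False
  define v where "v = ip (\<lambda>\<eta>. f \<eta> - color_mean f \<eta>) (\<lambda>\<eta>. f \<eta> - color_mean f \<eta>)"
  have v: "0 \<le> v" using weight_nonneg by (auto simp: v_def weighted_inner_def mult.assoc intro!: sum_nonneg)
  have "1 / 2 * v \<le> \<rho> * v" by (rule mult_right_mono[OF _ v]) (use False in simp)
  also have "\<dots> \<le> 8 * dirichlet 1 f f" unfolding v_def by (rule deviation_bound_exchange)
  finally have "v \<le> 16 * dirichlet 1 f f" by simp
  moreover have "2 / \<epsilon>\<^sup>2 * dirichlet 0 f f \<le> 2 / \<epsilon>\<^sup>2 * dirichlet 1 f f"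
    by (rule mult_left_mono[OF dirichlet_mono]) simp
  ultimately have "ip f f \<le> (2 / \<epsilon>\<^sup>2 + 16) * dirichlet 1 f f"
    using color_mean_gap[OF assms] unfolding inner_decomposition[of f] v_def[symmetric] distrib_right by linarith
  also have "\<dots> \<le> 2 * gap_scale * dirichlet 1 f f"
  proof (rule mult_right_mono)
    have "0 \<le> 2 / \<epsilon>\<^sup>2" by simp
    thus "2 / \<epsilon>\<^sup>2 + 16 \<le> 2 * gap_scale" using gap_scale_ge by linarith
  qed (rule dirichlet_nonneg, simp)
  finally show ?thesis .
qed

section \<open>From the weights to the conditioned measure\<close>

lemma configs_nonempty: "X \<noteq> {}"
proof -
  have "(\<Sum>k = 1..m. \<omega> k) \<le> card sites" using particles_less by simp
  from coloring_exists[OF finite_atLeastAtMost this]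
  obtain \<eta> where "\<And>i. \<eta> i \<le> m" "\<And>i. i \<notin> sites \<Longrightarrow> \<eta> i = 0"
    "\<And>k. k \<in> {1..m} \<Longrightarrow> card {i \<in> sites. \<eta> i = k} = \<omega> k" by blast
  hence "\<eta> \<in> X"
    by (simp add: configs_def PiE_dflt_def of_bool_def sum.If_cases Int_def)
  thus ?thesis by blast
qed

lemma two_configs:
  obtains \<eta> \<zeta> where "\<eta> \<in> X" "\<zeta> \<in> X" "\<eta> \<noteq> \<zeta>"
proof -
  obtain \<eta> where \<eta>: "\<eta> \<in> X" using configs_nonempty by blast
  have "{i \<in> sites. \<eta> i \<noteq> 0} \<noteq> {}" "{i \<in> sites. \<eta> i = 0} \<noteq> {}"
    using card_occupied[OF \<eta>] card_empty[OF \<eta>] particles_pos particles_less by (auto simp only: card.empty)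
  then obtain x y where xy: "x \<in> sites" "\<eta> x \<noteq> 0" "y \<in> sites" "\<eta> y = 0" by blast
  have "swap \<eta> x y x = 0" using xy by simp
  hence "\<eta> \<noteq> swap \<eta> x y" using xy(2) by metis
  thus ?thesis using that \<eta> swap_config[OF \<eta> xy(1,3)] by blast
qed

lemma pmf_nu_weight: "\<exists>Z>0. \<forall>\<eta>\<in>X. pmf (nu m N p \<omega>) \<eta> = weight \<eta> / Z"
proof -
  define M where "M = Pi_pmf {1..N} 0 (\<lambda>i. site_law m (p i))"
  define Z where "Z = (\<Prod>i\<in>sites. (real m - 1) * p i + 1)"
  have p: "\<And>i. i \<in> {1..N} \<Longrightarrow> 0 < p i \<and> p i < 1" using p_pos p_less by blast
  have Z: "Z > 0"
    unfolding Z_def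
  proof (intro prod_pos)
    fix i assume "i \<in> sites"
    hence "0 \<le> (real m - 1) * p i" using colors p_pos[of i] by simp
    thus "0 < (real m - 1) * p i + 1" by simp
  qed
  have M: "pmf M \<eta> = weight \<eta> / Z" if \<eta>: "\<eta> \<in> X" for \<eta>
  proof -
    have "pmf M \<eta> = (\<Prod>i\<in>sites. pmf (site_law m (p i)) (\<eta> i))"
      unfolding M_def using config_outside[OF \<eta>] by (subst pmf_Pi) auto
    also have "\<dots> = (\<Prod>i\<in>sites. site_weight i (\<eta> i) / ((real m - 1) * p i + 1))"
    proof (intro prod.cong refl)
      fix i assume "i \<in> sites"
      thus "pmf (site_law m (p i)) (\<eta> i) = site_weight i (\<eta> i) / ((real m - 1) * p i + 1)"
        using config_le[OF \<eta>, of i] p[of i] colors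
        by (subst pmf_site_law) (auto simp: site_weight_def)
    qed
    finally show ?thesis by (simp add: weight_def Z_def prod_dividef)
  qed
  obtain \<eta> where \<eta>: "\<eta> \<in> X" using configs_nonempty by blast
  have "0 < pmf M \<eta>" using M[OF \<eta>] Z weight_pos[of \<eta>] by simp
  also have "pmf M \<eta> = measure_pmf.prob M {\<eta>}" by (simp add: pmf.rep_eq)
  also have "\<dots> \<le> measure_pmf.prob M X" using \<eta> by (intro measure_pmf.finite_measure_mono) auto
  finally have P: "0 < measure_pmf.prob M X" .
  show ?thesis
  proof (intro exI[of _ "Z * measure_pmf.prob M X"] conjI ballI)
    show "0 < Z * measure_pmf.prob M X" using Z P by simp
    fix \<eta> assume "\<eta> \<in> X"
    thus "pmf (nu m N p \<omega>) \<eta> = weight \<eta> / (Z * measure_pmf.prob M X)"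
      using pmf_nu(2)[of m N p \<omega> \<eta>, OF colors p configs_nonempty] M[of \<eta>] by (simp add: M_def)
  qed
qed

text \<open>Expectations under \<nu> are weighted sums over \<open>X\<close> divided by a common
  constant, which cancels in the quotient. A lower bound for the infimum also requires an admissible
  test function to exist.\<close>

lemma spectral_gap_ge:
  assumes poincare: "\<And>f. (\<Sum>\<eta>\<in>X. weight \<eta> * f \<eta>) = 0 \<Longrightarrow> c * ip f f \<le> dirichlet \<gamma> f f"
  shows "c \<le> spectral_gap \<gamma> m N p \<omega>"
proof -
  obtain Z where Z: "0 < Z" "\<And>\<eta>. \<eta> \<in> X \<Longrightarrow> pmf (nu m N p \<omega>) \<eta> = weight \<eta> / Z"
    using pmf_nu_weight by blast
  have support: "set_pmf (nu m N p \<omega>) = X"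
    by (rule pmf_nu(1)[OF colors _ configs_nonempty]) (use p_pos p_less in blast)
  have E: "measure_pmf.expectation (nu m N p \<omega>) f = (\<Sum>\<eta>\<in>X. weight \<eta> * f \<eta>) / Z" for f
  proof -
    have "measure_pmf.expectation (nu m N p \<omega>) f = (\<Sum>\<eta>\<in>X. f \<eta> * pmf (nu m N p \<omega>) \<eta>)"
      by (rule integral_measure_pmf_real[OF finite_configs]) (simp add: support)
    also have "\<dots> = (\<Sum>\<eta>\<in>X. weight \<eta> * f \<eta> / Z)"
      by (intro sum.cong refl) (simp add: Z(2))
    finally show ?thesis by (simp only: sum_divide_distrib)
  qed
  show ?thesis
    unfolding spectral_gap_def
  proof (rule cInf_greatest)
    obtain \<eta> \<zeta> where \<eta>\<zeta>: "\<eta> \<in> X" "\<zeta> \<in> X" "\<eta> \<noteq> \<zeta>" by (rule two_configs)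
    \<comment> \<open>Supported on two configurations, with their weights crossed so that the mean
      vanishes.\<close>
    define f where "f \<xi> = of_bool (\<xi> = \<eta>) * weight \<zeta> - of_bool (\<xi> = \<zeta>) * weight \<eta>" for \<xi>
    have "(\<Sum>\<xi>\<in>X. weight \<xi> * f \<xi>)
        = (\<Sum>\<xi>\<in>X. if \<xi> = \<eta> then weight \<eta> * weight \<zeta> else 0) - (\<Sum>\<xi>\<in>X. if \<xi> = \<zeta> then weight \<eta> * weight \<zeta> else 0)"
      unfolding sum_subtractf[symmetric] by (intro sum.cong refl) (auto simp: f_def)
    also have "\<dots> = 0" using \<eta>\<zeta> by (simp add: sum.delta finite_configs)
    finally have "measure_pmf.expectation (nu m N p \<omega>) f = 0" by (simp add: E)
    moreover have "f \<eta> \<noteq> 0" using \<eta>\<zeta>(3) weight_pos[of \<zeta>] by (simp add: f_def)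
    ultimately show "{measure_pmf.expectation (nu m N p \<omega>) (\<lambda>\<eta>. f \<eta> * (- generator \<gamma> N p f \<eta>)) /
      measure_pmf.expectation (nu m N p \<omega>) (\<lambda>\<eta>. (f \<eta>)\<^sup>2) | f.
      (\<exists>\<eta>\<in>X. f \<eta> \<noteq> 0) \<and> measure_pmf.expectation (nu m N p \<omega>) f = 0} \<noteq> {}"
      using \<eta>\<zeta>(1) by blast
  next
    fix x assume "x \<in> {measure_pmf.expectation (nu m N p \<omega>) (\<lambda>\<eta>. f \<eta> * (- generator \<gamma> N p f \<eta>)) /
      measure_pmf.expectation (nu m N p \<omega>) (\<lambda>\<eta>. (f \<eta>)\<^sup>2) | f.
      (\<exists>\<eta>\<in>X. f \<eta> \<noteq> 0) \<and> measure_pmf.expectation (nu m N p \<omega>) f = 0}"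
    then obtain f \<eta> where x: "x = measure_pmf.expectation (nu m N p \<omega>) (\<lambda>\<eta>. f \<eta> * (- generator \<gamma> N p f \<eta>)) /
        measure_pmf.expectation (nu m N p \<omega>) (\<lambda>\<eta>. (f \<eta>)\<^sup>2)"
      and \<eta>: "\<eta> \<in> X" "f \<eta> \<noteq> 0" and mean: "measure_pmf.expectation (nu m N p \<omega>) f = 0" by blast
    have "(\<Sum>\<eta>\<in>X. weight \<eta> * f \<eta>) = 0" using mean Z(1) by (simp add: E)
    hence gap: "c * ip f f \<le> dirichlet \<gamma> f f" by (rule poincare)
    have norm: "(\<Sum>\<eta>\<in>X. weight \<eta> * (f \<eta>)\<^sup>2) = ip f f"
      by (simp add: weighted_inner_def power2_eq_square mult.assoc)
    have energy: "(\<Sum>\<eta>\<in>X. weight \<eta> * (f \<eta> * (- generator \<gamma> N p f \<eta>))) = dirichlet \<gamma> f f"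
      using inner_gen[of f \<gamma> f] by (simp add: weighted_inner_def generator_eq_gen mult.assoc sum_negf)
    have "0 < (\<Sum>\<eta>\<in>X. weight \<eta> * (f \<eta>)\<^sup>2)"
      by (rule sum_pos2[OF finite_configs \<eta>(1)]) (use \<eta>(2) weight_pos weight_nonneg in auto)
    hence "0 < ip f f" by (simp only: norm)
    have "x = dirichlet \<gamma> f f / ip f f"
      unfolding x E norm energy using Z(1) by simp
    thus "c \<le> x" using gap \<open>0 < ip f f\<close> by (simp add: pos_le_divide_eq)
  qed
qed

theorem spectral_gap_exchange: "1 / (2 * gap_scale) \<le> spectral_gap 1 m N p \<omega>"
proof (rule spectral_gap_ge)
  fix f assume "(\<Sum>\<eta>\<in>X. weight \<eta> * f \<eta>) = 0"
  from poincare_exchange[OF this] show "1 / (2 * gap_scale) * ip f f \<le> dirichlet 1 f f"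
    using gap_scale_pos by (simp add: pos_divide_le_eq mult.commute)
qed

theorem spectral_gap_hop: "1 / gap_scale * (1 - \<rho>) \<le> spectral_gap 0 m N p \<omega>"
proof (rule spectral_gap_ge)
  fix f assume "(\<Sum>\<eta>\<in>X. weight \<eta> * f \<eta>) = 0"
  from poincare_hop[OF this] show "1 / gap_scale * (1 - \<rho>) * ip f f \<le> dirichlet 0 f f"
    using gap_scale_pos by (simp add: pos_divide_le_eq mult.commute)
qed

end

theorem theorem3p4:
  fixes \<epsilon> :: real
  assumes "\<epsilon> > 0"
  shows "(\<exists>c::real. c > 0 \<and>
      (\<forall>(m::nat) (N::nat) (p::nat \<Rightarrow> real) (\<omega>::nat \<Rightarrow> nat).
        m > 1 \<longrightarrow> N \<ge> 2 \<longrightarrow> (\<forall>i\<in>{1..N}. \<epsilon> \<le> p i \<and> p i \<le> 1 - \<epsilon>) \<longrightarrow>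
        (\<Sum>k = 1..m. \<omega> k) \<le> N \<longrightarrow> 0 < global_density m N \<omega> \<longrightarrow> global_density m N \<omega> < 1 \<longrightarrow>
        spectral_gap 1 m N p \<omega> \<ge> c)) \<and>
    (\<exists>c::real. c > 0 \<and>
      (\<forall>(m::nat) (N::nat) (p::nat \<Rightarrow> real) (\<omega>::nat \<Rightarrow> nat).
        m > 1 \<longrightarrow> N \<ge> 2 \<longrightarrow> (\<forall>i\<in>{1..N}. \<epsilon> \<le> p i \<and> p i \<le> 1 - \<epsilon>) \<longrightarrow>
        (\<Sum>k = 1..m. \<omega> k) \<le> N \<longrightarrow> 0 < global_density m N \<omega> \<longrightarrow> global_density m N \<omega> < 1 \<longrightarrow>
        spectral_gap 0 m N p \<omega> \<ge> c * (1 - global_density m N \<omega>)))"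
proof -
  \<comment> \<open>The value of \<open>gap_scale\<close>, written outside the locale so that the
    witnesses are chosen from \<epsilon> alone, before m, N, p and \<omega>.\<close>
  define K where "K = 2 / \<epsilon>\<^sup>2 + 12 * (1 + 2 / \<epsilon>\<^sup>2) / \<epsilon>\<^sup>2"
  have K: "0 < K" unfolding K_def using assms by (intro add_pos_pos divide_pos_pos mult_pos_pos) auto
  have exclusion: "colored_exclusion m N p \<omega> \<epsilon>"
    if "m > 1" "N \<ge> 2" and p: "\<forall>i\<in>{1..N}. \<epsilon> \<le> p i \<and> p i \<le> 1 - \<epsilon>"
      and density: "0 < global_density m N \<omega>" "global_density m N \<omega> < 1" for m N p \<omega>
  proof
    have eq: "global_density m N \<omega> = real (\<Sum>k = 1..m. \<omega> k) / real N" by (simp add: global_density_def)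
    have N: "0 < real N" using that(2) by simp
    show "0 < (\<Sum>k = 1..m. \<omega> k)" "(\<Sum>k = 1..m. \<omega> k) < N"
      using density N unfolding eq
      by (simp_all only: zero_less_divide_iff divide_less_eq_1_pos of_nat_less_iff of_nat_0_less_iff) auto
  qed (use that assms in auto)
  have gap_scale: "colored_exclusion.gap_scale \<epsilon> = K" if "colored_exclusion m N p \<omega> \<epsilon>" for m N p \<omega>
    using colored_exclusion.gap_scale_def[OF that] by (simp only: K_def)
  show ?thesis
  proof (rule conjI[OF exI[of _ "1 / (2 * K)"] exI[of _ "1 / K"]]; intro conjI allI impI)
    show "0 < 1 / (2 * K)" "0 < 1 / K" using K by simp_all
  next
    fix m N p \<omega>
    assume "m > 1" "N \<ge> 2" "\<forall>i\<in>{1..N}. \<epsilon> \<le> p i \<and> p i \<le> 1 - \<epsilon>" "(\<Sum>k = 1..m. \<omega> k) \<le> N"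
      "0 < global_density m N \<omega>" "global_density m N \<omega> < 1"
    hence exc: "colored_exclusion m N p \<omega> \<epsilon>" by (intro exclusion)
    show "1 / (2 * K) \<le> spectral_gap 1 m N p \<omega>"
      using colored_exclusion.spectral_gap_exchange[OF exc] by (simp only: gap_scale[OF exc])
    show "1 / K * (1 - global_density m N \<omega>) \<le> spectral_gap 0 m N p \<omega>"
      using colored_exclusion.spectral_gap_hop[OF exc] by (simp only: gap_scale[OF exc])
  qed
qed

end
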